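(* If a compact subset $K\subset\partial\mathbb{D}$ of positive Lebesgue measure satisfies the SA-property with respect to $\mathcal{B}_0$, then it is removable for the analytic Sobolev space $W^1_a$.
   Context: $\mathbb{D}$ is the open unit disc, $\partial\mathbb{D}$ the unit circle, $dA$ area measure. The little Bloch space $\mathcal{B}_0$ is the Banach space of holomorphic $f$ in $\mathbb{D}$ with $\lim_{|z|\to1-}(1-|z|)f'(z)=0$, with norm $\|f\|_{\mathcal{B}}=|f(0)|+\sup_{z\in\mathbb{D}}(1-|z|)|f'(z)|$. For a measurable set $E\subseteq\partial\mathbb{D}$, $\mathcal{P}_E(\mathcal{B}_0)$ is the closure of $\{(Q,Q):Q\text{ analytic polynomial}\}$ in $\mathcal{B}_0\oplus L^\infty(E)$, with the norm topology on $\mathcal{B}_0$ and the weak-star topology on $L^\infty(E)$ (as dual of $L^1(E)$). $E$ satisfies the SA-property with respect to $\mathcal{B}_0$ if $\mathcal{P}_E(\mathcal{B}_0)=\mathcal{B}_0\oplus L^\infty(E)$. For open $\Omega\subseteq\mathbb{C}$, $W^1_a(\Omega)$ is the space of holomorphic $f$ in $\Omega$ with $\int_\Omega|f'|\,dA<\infty$. A compact set $K\subset\mathbb{C}$ is removable for $W^1_a$ if $W^1_a(\mathbb{C}\setminus K)$ consists only of constants. *)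

theory Defs
  imports "HOL-Complex_Analysis.Complex_Analysis"
begin

(* Members are extensional (fixed off the disc), so that a member is determined by its values on
   the disc and the Bloch norm induces a genuine metric. *)
definition little_bloch :: "(complex \<Rightarrow> complex) set" where
  "little_bloch = {f \<in> extensional (ball 0 1). f holomorphic_on ball 0 1 \<and>
     ((\<lambda>z. complex_of_real (1 - cmod z) * deriv f z) \<longlongrightarrow> 0) (filtercomap cmod (at_left 1))}"

definition bloch_norm :: "(complex \<Rightarrow> complex) \<Rightarrow> real" where
  "bloch_norm f = cmod (f 0) + (SUP z\<in>ball 0 1. (1 - cmod z) * cmod (deriv f z))"

(* The library's metric axioms ask for nonnegativity and symmetry on the whole type, hence the
   default value off the carrier; mtopology only looks at members of little_bloch. *)
definition bloch_dist :: "(complex \<Rightarrow> complex) \<Rightarrow> (complex \<Rightarrow> complex) \<Rightarrow> real" where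
  "bloch_dist f g =
     (if f \<in> little_bloch \<and> g \<in> little_bloch then bloch_norm (\<lambda>z. f z - g z) else 0)"

definition little_bloch_topology :: "(complex \<Rightarrow> complex) topology" where
  "little_bloch_topology = Metric_space.mtopology little_bloch bloch_dist"

(* Lebesgue (arc length) measure on the unit circle, completed, so that its measurable sets
   are the Lebesgue measurable subsets of the circle. *)
definition circle_measure :: "complex measure" where
  "circle_measure = completion
     (distr (restrict_space lborel {0..<2 * pi}) (restrict_space borel (sphere 0 1)) cis)"

definition L1_circle :: "complex set \<Rightarrow> (complex \<Rightarrow> complex) set" where
  "L1_circle E = {h. integrable (restrict_space circle_measure E) h}"

(* Functions rather than classes modulo null sets. Functions agreeing a.e. on E are
   indistinguishable in the topology below, so closures (of any set) are saturated with respect to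
   a.e. equality and correspond exactly to closures in the quotient. *)
definition Linf_circle :: "complex set \<Rightarrow> (complex \<Rightarrow> complex) set" where
  "Linf_circle E = {g \<in> borel_measurable (restrict_space circle_measure E).
     \<exists>C. AE x in restrict_space circle_measure E. cmod (g x) \<le> C}"

(* The coarsest topology for which all pairings with integrable h are continuous. *)
definition weak_star_topology :: "complex set \<Rightarrow> (complex \<Rightarrow> complex) topology" where
  "weak_star_topology E = pullback_topology (Linf_circle E)
     (\<lambda>g. \<lambda>h\<in>L1_circle E. \<integral>x. g x * h x \<partial>restrict_space circle_measure E)
     (product_topology (\<lambda>_. euclidean) (L1_circle E))"

definition poly_closure :: "complex set \<Rightarrow> ((complex \<Rightarrow> complex) \<times> (complex \<Rightarrow> complex)) set" where
  "poly_closure E = prod_topology little_bloch_topology (weak_star_topology E) closure_of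
     {(restrict (poly Q) (ball 0 1), poly Q) | Q. True}"

definition SA_property :: "complex set \<Rightarrow> bool" where
  "SA_property E \<longleftrightarrow> poly_closure E = little_bloch \<times> Linf_circle E"

definition analytic_sobolev :: "complex set \<Rightarrow> (complex \<Rightarrow> complex) set" where
  "analytic_sobolev \<Omega> = {f. f holomorphic_on \<Omega> \<and>
     (\<integral>\<^sup>+z\<in>\<Omega>. ennreal (cmod (deriv f z)) \<partial>lborel) < \<infinity>}"

definition removable_analytic_sobolev :: "complex set \<Rightarrow> bool" where
  "removable_analytic_sobolev K \<longleftrightarrow>
     compact K \<and> (\<forall>f \<in> analytic_sobolev (- K). f constant_on (- K))"

lemma little_bloch_bdd:
  assumes f: "f \<in> little_bloch"
  shows "bdd_above ((\<lambda>z. (1 - cmod z) * cmod (deriv f z)) ` ball 0 1)"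
proof -
  let ?F = "\<lambda>z. (1 - cmod z) * cmod (deriv f z)"
  have hol: "f holomorphic_on ball 0 1"
    and lim: "((\<lambda>z. complex_of_real (1 - cmod z) * deriv f z) \<longlongrightarrow> 0) (filtercomap cmod (at_left 1))"
    using f by (auto simp: little_bloch_def)
  have "\<forall>\<^sub>F z in filtercomap cmod (at_left 1). cmod (complex_of_real (1 - cmod z) * deriv f z) < 1"
    using tendstoD[OF lim, of 1] by simp
  then obtain P where P: "eventually P (at_left (1::real))"
    and PF: "\<And>z. P (cmod z) \<Longrightarrow> cmod (complex_of_real (1 - cmod z) * deriv f z) < 1"
    by (auto simp: eventually_filtercomap)
  then obtain b where b: "b < 1" "\<And>r. b < r \<Longrightarrow> r < 1 \<Longrightarrow> P r"
    by (auto simp: eventually_at_left_field)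
  have "continuous_on (ball 0 1) (deriv f)"
    by (intro holomorphic_on_imp_continuous_on holomorphic_deriv hol) auto
  then have "continuous_on (cball 0 b) ?F"
    by (intro continuous_intros) (use b in \<open>auto intro: continuous_on_subset\<close>)
  then have "bounded (?F ` cball 0 b)"
    by (intro compact_imp_bounded compact_continuous_image) auto
  then obtain C where C: "\<And>z. z \<in> cball 0 b \<Longrightarrow> ?F z \<le> C"
    unfolding bounded_iff real_norm_def by (metis abs_le_D1 imageI)
  have "?F z \<le> max C 1" if z: "z \<in> ball 0 1" for z
  proof (cases "cmod z \<le> b")
    case True
    then show ?thesis using C[of z] by simp
  next
    case False
    then have "cmod (complex_of_real (1 - cmod z) * deriv f z) < 1"
      using PF b z by auto
    moreover have "cmod (complex_of_real (1 - cmod z) * deriv f z) = ?F z"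
      using z by (simp only: norm_mult norm_of_real) simp
    ultimately show ?thesis by simp
  qed
  then show ?thesis by (intro bdd_aboveI2)
qed

lemma deriv_little_bloch_diff:
  assumes "f \<in> little_bloch" "g \<in> little_bloch" "z \<in> ball 0 1"
  shows "deriv (\<lambda>w. f w - g w) z = deriv f z - deriv g z"
proof -
  have "f field_differentiable at z" "g field_differentiable at z"
    using assms by (auto simp: little_bloch_def intro: holomorphic_on_imp_differentiable_at[of _ "ball 0 1"])
  then show ?thesis by (rule deriv_diff)
qed

lemma bloch_dist_eq:
  assumes "f \<in> little_bloch" "g \<in> little_bloch"
  shows "bloch_dist f g =
    cmod (f 0 - g 0) + (SUP z\<in>ball 0 1. (1 - cmod z) * cmod (deriv f z - deriv g z))"
  unfolding bloch_dist_def bloch_norm_def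
  by (simp add: assms deriv_little_bloch_diff[OF assms] cong: SUP_cong_simp)

lemma little_bloch_diff_bdd:
  assumes "f \<in> little_bloch" "g \<in> little_bloch"
  shows "bdd_above ((\<lambda>z. (1 - cmod z) * cmod (deriv f z - deriv g z)) ` ball 0 1)"
proof -
  obtain C where "\<And>z. z \<in> ball 0 1 \<Longrightarrow> (1 - cmod z) * cmod (deriv f z) \<le> C"
    using little_bloch_bdd[OF assms(1)] unfolding bdd_above_def by blast
  moreover obtain D where "\<And>z. z \<in> ball 0 1 \<Longrightarrow> (1 - cmod z) * cmod (deriv g z) \<le> D"
    using little_bloch_bdd[OF assms(2)] unfolding bdd_above_def by blast
  moreover have "(1 - cmod z) * cmod (deriv f z - deriv g z) \<le>
      (1 - cmod z) * cmod (deriv f z) + (1 - cmod z) * cmod (deriv g z)" if "z \<in> ball 0 1" for z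
    using that by (simp flip: distrib_left add: mult_left_mono norm_triangle_ineq4)
  ultimately show ?thesis
    by (intro bdd_aboveI2[of _ _ "C + D"]) (meson add_mono order_trans)
qed

lemma little_bloch_diff_upper:
  assumes "f \<in> little_bloch" "g \<in> little_bloch" "z \<in> ball 0 1"
  shows "(1 - cmod z) * cmod (deriv f z - deriv g z) \<le>
    (SUP z\<in>ball 0 1. (1 - cmod z) * cmod (deriv f z - deriv g z))"
  by (rule cSUP_upper[OF assms(3) little_bloch_diff_bdd[OF assms(1,2)]])

lemma little_bloch_diff_Sup_nonneg:
  assumes "f \<in> little_bloch" "g \<in> little_bloch"
  shows "0 \<le> (SUP z\<in>ball 0 1. (1 - cmod z) * cmod (deriv f z - deriv g z))"
  using little_bloch_diff_upper[OF assms, of 0]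
  by (auto intro: order_trans[OF norm_ge_zero])

lemma Metric_space_little_bloch: "Metric_space little_bloch bloch_dist"
proof
  show "0 \<le> bloch_dist f g" for f g
  proof (cases "f \<in> little_bloch \<and> g \<in> little_bloch")
    case True
    then show ?thesis
      using little_bloch_diff_Sup_nonneg[of f g] by (simp add: bloch_dist_eq)
  qed (auto simp: bloch_dist_def)
  show "bloch_dist f g = bloch_dist g f" for f g
  proof (cases "f \<in> little_bloch \<and> g \<in> little_bloch")
    case True
    then show ?thesis by (simp add: bloch_dist_eq norm_minus_commute)
  qed (auto simp: bloch_dist_def)
next
  fix f g assume f: "f \<in> little_bloch" and g: "g \<in> little_bloch"
  show "bloch_dist f g = 0 \<longleftrightarrow> f = g"
  proof
    assume "bloch_dist f g = 0"
    then have z0: "f 0 - g 0 = 0"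
      and S0: "(SUP z\<in>ball 0 1. (1 - cmod z) * cmod (deriv f z - deriv g z)) = 0"
      using little_bloch_diff_Sup_nonneg[OF f g] norm_ge_zero[of "f 0 - g 0"]
      unfolding bloch_dist_eq[OF f g] by (smt (verit) norm_eq_zero)+
    have hol: "f holomorphic_on ball 0 1" "g holomorphic_on ball 0 1"
      using f g by (auto simp: little_bloch_def)
    have D0: "deriv f z - deriv g z = 0" if "z \<in> ball 0 1" for z
    proof -
      have "(1 - cmod z) * cmod (deriv f z - deriv g z) \<le> 0"
        using little_bloch_diff_upper[OF f g that] S0 by simp
      then show ?thesis using that by (auto simp: mult_le_0_iff)
    qed
    have der: "((\<lambda>w. f w - g w) has_field_derivative 0) (at z within ball 0 1)" if "z \<in> ball 0 1" for z
      using DERIV_diff[OF holomorphic_derivI[OF hol(1) open_ball that]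
          holomorphic_derivI[OF hol(2) open_ball that]] D0[OF that] by simp
    obtain c where c: "\<And>z. z \<in> ball 0 1 \<Longrightarrow> f z - g z = c"
      using has_field_derivative_zero_constant[OF convex_ball der] by blast
    have "f z = g z" if "z \<in> ball 0 1" for z
      using c[OF that] c[of 0] z0 by simp
    then show "f = g"
      using f g by (auto simp: little_bloch_def intro: extensionalityI)
  next
    assume "f = g"
    then show "bloch_dist f g = 0" by (simp add: bloch_dist_eq g)
  qed
next
  fix f g h assume f: "f \<in> little_bloch" and g: "g \<in> little_bloch" and h: "h \<in> little_bloch"
  let ?S = "\<lambda>f g. SUP z\<in>ball 0 1. (1 - cmod z) * cmod (deriv f z - deriv g z)"
  have "?S f h \<le> ?S f g + ?S g h"
  proof (rule cSUP_least)
    fix z :: complex assume z: "z \<in> ball 0 1"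
    have "(1 - cmod z) * cmod (deriv f z - deriv h z) \<le>
        (1 - cmod z) * (cmod (deriv f z - deriv g z) + cmod (deriv g z - deriv h z))"
      using z norm_triangle_ineq[of "deriv f z - deriv g z" "deriv g z - deriv h z"]
      by (intro mult_left_mono) auto
    also have "\<dots> \<le> ?S f g + ?S g h"
      using little_bloch_diff_upper[OF f g z] little_bloch_diff_upper[OF g h z]
      by (simp add: distrib_left)
    finally show "(1 - cmod z) * cmod (deriv f z - deriv h z) \<le> ?S f g + ?S g h" .
  qed auto
  moreover have "cmod (f 0 - h 0) \<le> cmod (f 0 - g 0) + cmod (g 0 - h 0)"
    using norm_triangle_ineq[of "f 0 - g 0" "g 0 - h 0"] by simp
  ultimately show "bloch_dist f h \<le> bloch_dist f g + bloch_dist g h"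
    by (simp add: bloch_dist_eq f g h)
qed

lemma topspace_little_bloch [simp]: "topspace little_bloch_topology = little_bloch"
  by (simp add: little_bloch_topology_def Metric_space.topspace_mtopology[OF Metric_space_little_bloch])

lemma topspace_weak_star [simp]: "topspace (weak_star_topology E) = Linf_circle E"
  by (auto simp: weak_star_topology_def topspace_pullback_topology topspace_product_topology)

lemma space_circle_measure [simp]: "space circle_measure = sphere 0 1"
  by (simp add: circle_measure_def space_restrict_space)

lemma emeasure_circle_measure: "emeasure circle_measure (sphere 0 1) = ennreal (2 * pi)"
proof -
  have cis: "cis \<in> restrict_space lborel {0..<2 * pi} \<rightarrow>\<^sub>M restrict_space borel (sphere 0 1)"
    by (intro measurable_restrict_space2 measurable_restrict_space1)
       (auto intro!: borel_measurable_continuous_onI continuous_intros)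
  have "sphere 0 1 \<in> sets (restrict_space borel (sphere (0::complex) 1))"
    by (simp add: sets_restrict_space image_iff) (metis Int_absorb2 Int_commute sets.top space_borel top_greatest)
  moreover have "cis -` sphere 0 1 \<inter> {0..<2 * pi} = {0..<2 * pi}" by auto
  ultimately show ?thesis
    by (simp add: circle_measure_def emeasure_distr[OF cis] emeasure_completion space_restrict_space
        emeasure_restrict_space Int_absorb1)
qed

lemma sets_circle_measure_compact:
  assumes "compact K" "K \<subseteq> sphere 0 1"
  shows "K \<in> sets circle_measure"
  using assms by (auto simp: circle_measure_def sets_restrict_space image_iff Int_absorb1
      intro!: sets_completionI_sets borel_compact bexI[of _ K])

lemma poly_in_little_bloch: "restrict (poly Q) (ball 0 1) \<in> little_bloch"
proof -
  let ?f = "restrict (poly Q) (ball 0 1)"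
  have d: "deriv ?f z = poly (pderiv Q) z" if "z \<in> ball 0 1" for z
    by (rule DERIV_imp_deriv, rule has_field_derivative_transform_within_open[OF poly_DERIV open_ball that])
      auto
  have "?f holomorphic_on ball 0 1"
    by (rule holomorphic_transform[of "poly Q"]) (auto intro!: holomorphic_intros)
  moreover have "((\<lambda>z. complex_of_real (1 - cmod z) * deriv ?f z) \<longlongrightarrow> 0) (filtercomap cmod (at_left 1))"
  proof -
    have "bounded (poly (pderiv Q) ` cball 0 1)"
      by (intro compact_imp_bounded compact_continuous_image continuous_intros) auto
    then obtain C where C: "\<And>z. cmod z \<le> 1 \<Longrightarrow> cmod (poly (pderiv Q) z) \<le> C"
      by (force simp: bounded_iff)
    have ev: "\<forall>\<^sub>F z in filtercomap cmod (at_left 1). cmod z < 1"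
      by (auto simp: eventually_filtercomap eventually_at_filter intro!: exI[of _ "\<lambda>r. r < 1"])
    show ?thesis
    proof (rule Lim_null_comparison)
      show "\<forall>\<^sub>F z in filtercomap cmod (at_left 1).
          cmod (complex_of_real (1 - cmod z) * deriv ?f z) \<le> (1 - cmod z) * C"
        using ev
      proof eventually_elim
        case (elim z)
        have "cmod (complex_of_real (1 - cmod z) * deriv ?f z) = (1 - cmod z) * cmod (deriv ?f z)"
          using elim by (simp add: norm_mult del: of_real_diff)
        then show ?case using elim C[of z] d[of z] by (simp add: mult_left_mono)
      qed
      have "((\<lambda>r. (1 - r) * C) \<longlongrightarrow> (1 - 1) * C) (at_left 1)"
        by (intro tendsto_intros)
      from filterlim_compose[OF this filterlim_filtercomap]
      show "((\<lambda>z::complex. (1 - cmod z) * C) \<longlongrightarrow> 0) (filtercomap cmod (at_left 1))"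
        by simp
    qed
  qed
  ultimately show ?thesis by (auto simp: little_bloch_def)
qed

lemma sets_borel_le_circle_measure:
  "sets (restrict_space borel (sphere 0 1)) \<subseteq> sets circle_measure"
  by (auto simp: circle_measure_def intro!: sets_completionI_sets)

lemma poly_in_Linf_circle: "poly Q \<in> Linf_circle E"
proof -
  have "poly Q \<in> borel_measurable borel"
    by (intro borel_measurable_continuous_onI continuous_intros)
  then have "poly Q \<in> borel_measurable (restrict_space borel (sphere 0 1))"
    by (rule measurable_restrict_space1)
  then have "poly Q \<in> borel_measurable circle_measure"
    using sets_borel_le_circle_measure by (auto simp: measurable_def space_restrict_space)
  then have "poly Q \<in> borel_measurable (restrict_space circle_measure E)"
    by (rule measurable_restrict_space1)
  moreover have "bounded (poly Q ` sphere 0 1)"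
    by (intro compact_imp_bounded compact_continuous_image continuous_intros) auto
  then obtain C where "\<And>z. cmod z = 1 \<Longrightarrow> cmod (poly Q z) \<le> C"
    by (force simp: bounded_iff)
  then have "AE x in restrict_space circle_measure E. cmod (poly Q x) \<le> C"
    by (intro AE_I2) (auto simp: space_restrict_space)
  ultimately show ?thesis by (auto simp: Linf_circle_def)
qed

end

(* Let d_k and c_k be the Laurent coefficients of f inside and outside the circle. Since f' is
   integrable over the plane, f has a jump across the circle which lies in L^1, vanishes off K and has
   the Fourier coefficients d_k - c_k, where d_k = 0 for k < 0, and c_k = 0 for k > 0 by integrability
   of f' near infinity. A Green formula turns the pairing of a polynomial Q with the jump into an
   area integral of (1 - |z|) Q'(z) against f'(1/conj z), so it is bounded by the Bloch norm of Q.
   The SA-property approximates (0, z^(-n-1)) by pairs (Q, Q), whence d_n = c_n for all n >= 0; thus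
   d_n = 0 for n > 0 and f is constant on the disc, hence on the complement of K when K is not
   the whole circle. For the whole circle, the SA-property fails: f = 1 inside and 0 outside
   would have d_0 = c_0. *)
theory Submission
  imports Defs
begin

unbundle no fps_syntax

section \<open>The change of variables z = exp w\<close>

text \<open>Only the derivative of f is known to be integrable, so no boundary values are at hand.
  In the coordinate w = x + iy with z = exp w, circles become vertical lines, Laurent coefficients
  become Fourier coefficients over one period, and z f'(z) is the w-derivative of f(exp w). The area
  integral of |f'| becomes that of exp x |z f'(z)| dx dy, and Fubini replaces every limit at the
  circle. The Green formula is likewise obtained without boundary integration: it is checked on
  monomials. Differentiating f contributes a factor m + 2 up to sign, differentiating Q a factor m +
  1. The weight 1 - |z|^2 is the right one because the remaining x-integral is 1 / (2 (m + 1) (m +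
  2)), which cancels both. The pairing multiplies Q(z) by an extra z, so that only negative Fourier
  indices occur; there the inner coefficients vanish, and the area integral can be taken over the
  exterior alone.\<close>

lemma distr_lborel_basis_bij:
  fixes T :: "'a::euclidean_space \<Rightarrow> 'b::euclidean_space"
  assumes T: "linear T" and bij: "bij_betw T Basis Basis"
  shows "distr lborel borel T = lborel"
proof (rule lborel_eqI[symmetric])
  have meas [measurable]: "T \<in> borel_measurable borel"
    using T by (intro borel_measurable_continuous_onI linear_continuous_on) (simp add: linear_conv_bounded_linear)
  fix l u :: 'b assume lu: "\<And>b. b \<in> Basis \<Longrightarrow> l \<bullet> b \<le> u \<bullet> b"
  have inner: "T x \<bullet> T b = x \<bullet> b" if "b \<in> Basis" for x b
  proof -
    have "T x = (\<Sum>a\<in>Basis. (x \<bullet> a) *\<^sub>R T a)"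
      by (metis (no_types, lifting) T euclidean_representation linear_scale linear_sum sum.cong)
    also have "\<dots> \<bullet> T b = (\<Sum>a\<in>Basis. (x \<bullet> a) * (T a \<bullet> T b))"
      by (simp add: inner_sum_left)
    also have "\<dots> = (\<Sum>a\<in>Basis. (x \<bullet> a) * (if a = b then 1 else 0))"
    proof (rule sum.cong[OF refl])
      fix a :: 'a assume a: "a \<in> Basis"
      have "T a \<in> Basis" "T b \<in> Basis" "T a = T b \<longleftrightarrow> a = b"
        using bij a that by (auto simp: bij_betw_def inj_on_eq_iff)
      then show "(x \<bullet> a) * (T a \<bullet> T b) = (x \<bullet> a) * (if a = b then 1 else 0)"
        by (simp add: inner_Basis)
    qed
    finally show ?thesis using that by (simp add: if_distrib sum.delta cong: if_cong)
  qed
  \<comment> \<open>\<open>p\<close> is the adjoint, hence the inverse, of the isometry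
    \<open>T\<close>; preimages of boxes are therefore boxes with permuted side lengths.\<close>
  define p where "p y = (\<Sum>b\<in>Basis. (y \<bullet> T b) *\<^sub>R b)" for y
  have p: "p y \<bullet> b = y \<bullet> T b" if "b \<in> Basis" for y b
    using that by (simp add: p_def inner_sum_left inner_Basis if_distrib sum.delta cong: if_cong)
  have im: "T ` Basis = Basis" using bij by (simp add: bij_betw_def)
  have "T -` box l u = box (p l) (p u)"
    by (auto simp: box_def p im[symmetric] inner)
  then have "emeasure (distr lborel borel T) (box l u) = emeasure lborel (box (p l) (p u))"
    by (simp add: emeasure_distr)
  also have "\<dots> = (\<Prod>b\<in>Basis. (p u - p l) \<bullet> b)"
    using lu im by (intro emeasure_lborel_box) (auto simp: p)
  also have "(\<Prod>b\<in>Basis. (p u - p l) \<bullet> b) = (\<Prod>b\<in>Basis. (u - l) \<bullet> T b)"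
    by (rule prod.cong) (auto simp: p inner_diff_left)
  also have "\<dots> = (\<Prod>b\<in>Basis. (u - l) \<bullet> b)"
    by (rule prod.reindex_bij_betw[OF bij])
  finally show "emeasure (distr lborel borel T) (box l u) = (\<Prod>b\<in>Basis. (u - l) \<bullet> b)" .
qed simp

text \<open>The Jacobian theorem is formulated on \<open>real^n\<close> and Fubini on a product, so
  Lebesgue measure is carried between \<open>complex\<close>, \<open>real^2\<close> and
  \<open>real \<times> real\<close>.\<close>

definition vec2 :: "complex \<Rightarrow> real^2" where
  "vec2 z = vector [Re z, Im z]"

definition cplx2 :: "real^2 \<Rightarrow> complex" where
  "cplx2 v = Complex (v $ 1) (v $ 2)"

lemma cplx2_vec2 [simp]: "cplx2 (vec2 z) = z" and vec2_cplx2 [simp]: "vec2 (cplx2 v) = v"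
  by (simp_all add: cplx2_def vec2_def vec_eq_iff forall_2)

lemma linear_vec2: "linear vec2" and linear_cplx2: "linear cplx2"
  by (auto intro!: linearI simp: vec2_def cplx2_def vec_eq_iff forall_2 complex_eq_iff)

lemmas bounded_linear_vec2 = linear_vec2[unfolded linear_conv_bounded_linear]

lemmas bounded_linear_cplx2 = linear_cplx2[unfolded linear_conv_bounded_linear]

lemma Basis_real2: "(Basis :: (real^2) set) = {axis 1 1, axis 2 1}"
  by (auto simp: Basis_vec_def UNIV_2)

lemma cplx2_axis [simp]: "cplx2 (axis 1 1) = 1" "cplx2 (axis 2 1) = \<i>"
  by (simp_all add: cplx2_def axis_def complex_eq_iff)

lemma distr_lborel_cplx2: "distr lborel borel cplx2 = lborel"
  by (rule distr_lborel_basis_bij[OF linear_cplx2])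
     (auto simp: bij_betw_def Basis_real2 Basis_complex_def inj_on_def)

lemma distr_lborel_Complex: "distr (lborel \<Otimes>\<^sub>M lborel) borel (\<lambda>(x,y). Complex x y) = lborel"
  unfolding lborel_prod
  by (rule distr_lborel_basis_bij)
     (auto intro!: linearI simp: bij_betw_def Basis_prod_def Basis_complex_def inj_on_def complex_eq_iff)

lemma measurable_cplx2 [measurable]: "cplx2 \<in> borel_measurable borel"
  by (intro borel_measurable_continuous_onI linear_continuous_on bounded_linear_cplx2)

lemma measurable_vec2 [measurable]: "vec2 \<in> borel_measurable borel"
  by (intro borel_measurable_continuous_onI linear_continuous_on bounded_linear_vec2)

lemma measurable_Complex [measurable (raw)]:
  assumes "f \<in> borel_measurable M" "g \<in> borel_measurable M"
  shows "(\<lambda>x. Complex (f x) (g x)) \<in> borel_measurable M"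
  unfolding borel_measurable_complex_iff using assms by simp

text \<open>dA becomes exp (2x) dx dy. On the open strip \<open>exp\<close> is injective; its image
  omits a ray, which does no harm because integrability only has to be restricted to the
  image.\<close>

lemma integrable_exp_change_of_variables:
  fixes u :: "complex \<Rightarrow> complex"
  assumes u: "integrable lborel u"
  shows "integrable (lborel \<Otimes>\<^sub>M lborel)
    (\<lambda>(x,y). indicator {0<..<2*pi} y *\<^sub>R (exp (2 * x) *\<^sub>R u (exp (Complex x y))))"
proof -
  have [measurable]: "u \<in> borel_measurable borel" using u by simp
  let ?S = "{v::real^2. 0 < v$2 \<and> v$2 < 2*pi}"
  let ?g = "\<lambda>v. vec2 (exp (cplx2 v))"
  let ?g' = "\<lambda>v w. vec2 (exp (cplx2 v) * cplx2 w)"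
  let ?f = "\<lambda>v. vec2 (u (cplx2 v))"
  have "integrable (distr lborel borel cplx2) u" using u by (simp add: distr_lborel_cplx2)
  then have "integrable lborel (\<lambda>v. u (cplx2 v))" by (simp add: integrable_distr_eq)
  then have "integrable lborel ?f"
    by (rule integrable_bounded_linear[OF bounded_linear_vec2])
  then have fint: "?f absolutely_integrable_on UNIV"
    by (simp add: set_integrable_def integrable_completion)
  have S: "?S \<in> sets borel" by measurable
  have inj: "inj_on ?g ?S"
  proof (rule inj_onI)
    fix v w assume vw: "v \<in> ?S" "w \<in> ?S" "?g v = ?g w"
    then have "exp (cplx2 v) = exp (cplx2 w)" by (metis cplx2_vec2)
    then have "cplx2 v = cplx2 w"
      using vw(1,2) by (elim exp_complex_eqI[rotated]) (auto simp: cplx2_def)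
    then show "v = w" by (metis vec2_cplx2)
  qed
  have der: "(?g has_derivative ?g' v) (at v within ?S)" for v
  proof -
    have "((\<lambda>v. exp (cplx2 v)) has_derivative (\<lambda>w. exp (cplx2 v) * cplx2 w)) (at v within ?S)"
      by (rule has_derivative_compose[OF bounded_linear_imp_has_derivative[OF bounded_linear_cplx2]
          DERIV_exp[unfolded has_field_derivative_def]])
    from bounded_linear.has_derivative[OF _ this, of vec2]
    show ?thesis by (simp add: bounded_linear_vec2)
  qed
  have det: "\<bar>det (matrix (?g' v))\<bar> = exp (2 * v $ 1)" for v
  proof -
    \<comment> \<open>Multiplication by a complex number has as real determinant its squared
      modulus.\<close>
    have "det (matrix (?g' v)) = (cmod (exp (cplx2 v)))\<^sup>2"
      unfolding cmod_power2 by (simp add: det_2 matrix_def vec2_def power2_eq_square)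
    then show ?thesis by (simp add: cplx2_def flip: exp_double)
  qed
  have "?f absolutely_integrable_on ?g ` ?S"
  proof -
    have "?g ` ?S \<in> sets lebesgue"
      by (rule differentiable_image_in_sets_lebesgue) (use S der in \<open>auto simp: differentiable_on_def differentiable_def\<close>)
    then show ?thesis using fint set_integrable_subset by blast
  qed
  then have "(\<lambda>v. \<bar>det (matrix (?g' v))\<bar> *\<^sub>R ?f (?g v)) absolutely_integrable_on ?S"
    using has_absolute_integral_change_of_variables[where f = ?f and g = ?g and g' = ?g', OF _ der inj] S by auto
  then have "(\<lambda>v. exp (2 * v $ 1) *\<^sub>R vec2 (u (exp (cplx2 v)))) absolutely_integrable_on ?S"
    by (simp add: det)
  then have "integrable lborel (\<lambda>v. indicator ?S v *\<^sub>R (exp (2 * v $ 1) *\<^sub>R vec2 (u (exp (cplx2 v)))))"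
    unfolding set_integrable_def using S by (subst (asm) integrable_completion) measurable
  from integrable_bounded_linear[OF bounded_linear_cplx2 this]
  have "integrable lborel (\<lambda>v. cplx2 (indicator ?S v *\<^sub>R (exp (2 * v $ 1) *\<^sub>R vec2 (u (exp (cplx2 v))))))" .
  then have "integrable lborel (\<lambda>v. indicator ?S v *\<^sub>R (exp (2 * v $ 1) *\<^sub>R u (exp (cplx2 v))))"
    by (simp add: linear_scale[OF linear_cplx2])
  also have "(\<lambda>v. indicator ?S v *\<^sub>R (exp (2 * v $ 1) *\<^sub>R u (exp (cplx2 v)))) =
      (\<lambda>v. (\<lambda>z. indicator {0<..<2*pi} (Im z) *\<^sub>R (exp (2 * Re z) *\<^sub>R u (exp z))) (cplx2 v))"
    by (auto simp: indicator_def cplx2_def fun_eq_iff)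
  finally have "integrable (distr lborel borel cplx2) (\<lambda>z. indicator {0<..<2*pi} (Im z) *\<^sub>R (exp (2 * Re z) *\<^sub>R u (exp z)))"
    by (subst integrable_distr_eq) simp_all
  then have "integrable (distr (lborel \<Otimes>\<^sub>M lborel) borel (\<lambda>(x,y). Complex x y))
     (\<lambda>z. indicator {0<..<2*pi} (Im z) *\<^sub>R (exp (2 * Re z) *\<^sub>R u (exp z)))"
    by (simp only: distr_lborel_cplx2 distr_lborel_Complex)
  then show ?thesis
    by (subst (asm) integrable_distr_eq) (simp_all add: case_prod_unfold)
qed

section \<open>Vertical integrals and the circle measure\<close>

lemma Complex_has_vector_derivative [derivative_intros]:
  "((\<lambda>y. Complex x y) has_vector_derivative \<i>) (at y within S)"
  "((\<lambda>x. Complex x y) has_vector_derivative 1) (at x within T)"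
  unfolding Complex_eq by (auto intro!: derivative_eq_intros simp: has_vector_derivative_def scaleR_conv_of_real)

lemma periodic_has_integral_deriv:
  assumes G: "\<And>y. (G has_field_derivative G' (Complex x y)) (at (Complex x y))"
    and per: "G (Complex x (2 * pi)) = G (Complex x 0)"
  shows "((\<lambda>y. G' (Complex x y)) has_integral 0) {0..2 * pi}"
proof -
  have "((\<lambda>y. G (Complex x y)) has_vector_derivative \<i> * G' (Complex x y)) (at y within {0..2*pi})" for y
    using field_vector_diff_chain_within[OF Complex_has_vector_derivative(1) has_field_derivative_at_within[OF G]]
    by (simp add: o_def)
  then have "((\<lambda>y. \<i> * G' (Complex x y)) has_integral 0) {0..2 * pi}"
    using fundamental_theorem_of_calculus[of 0 "2*pi" "\<lambda>y. G (Complex x y)" "\<lambda>y. \<i> * G' (Complex x y)"] per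
    by simp
  from has_integral_mult_right[OF this, of "-\<i>"] show ?thesis by simp
qed

text \<open>Cauchy's theorem on an annulus, in the logarithmic coordinate: the x-derivative of the
  period integral is the period integral of \<open>G'\<close>, which vanishes because
  \<open>G\<close> closes up after 2 pi i.\<close>

lemma periodic_integral_constant:
  assumes G: "\<And>w. Re w \<in> U \<Longrightarrow> (G has_field_derivative G' w) (at w)"
    and cont: "continuous_on {w. Re w \<in> U} G'"
    and per: "\<And>w. G (w + 2 * pi * \<i>) = G w"
    and U: "convex U" "x \<in> U" "x' \<in> U"
  shows "integral {0..2*pi} (\<lambda>y. G (Complex x y)) = integral {0..2*pi} (\<lambda>y. G (Complex x' y))"
proof -
  let ?I = "\<lambda>x. integral (cbox 0 (2*pi)) (\<lambda>y. G (Complex x y))"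
  have contG: "continuous_on {w. Re w \<in> U} G"
    by (rule DERIV_continuous_on[where D = G']) (use G in \<open>auto intro: has_field_derivative_at_within\<close>)
  have "(?I has_vector_derivative 0) (at x within U)" if x: "x \<in> U" for x
  proof -
    have "(?I has_vector_derivative integral (cbox 0 (2*pi)) (\<lambda>y. G' (Complex x y))) (at x within U)"
    proof (rule leibniz_rule_vector_derivative[OF _ _ _ x U(1)])
      show "((\<lambda>x. G (Complex x y)) has_vector_derivative G' (Complex x y)) (at x within U)" if "x \<in> U" for x y
        using field_vector_diff_chain_within[OF Complex_has_vector_derivative(2) has_field_derivative_at_within[OF G]] that
        by (simp add: o_def)
      show "(\<lambda>y. G (Complex x y)) integrable_on cbox 0 (2*pi)" if "x \<in> U" for x
        by (intro integrable_continuous continuous_on_compose2[OF contG])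
          (use that in \<open>auto simp: Complex_eq intro!: continuous_intros\<close>)
      show "continuous_on (U \<times> cbox 0 (2 * pi)) (\<lambda>(x, y). G' (Complex x y))"
        unfolding case_prod_unfold
        by (intro continuous_on_compose2[OF cont])
          (auto simp: Complex_eq intro!: continuous_intros)
    qed
    moreover have "integral (cbox 0 (2*pi)) (\<lambda>y. G' (Complex x y)) = 0"
      using periodic_has_integral_deriv[of G G' x] G x per[of "Complex x 0"]
      by (auto simp: integral_unique Complex_eq mult.commute)
    ultimately show ?thesis by simp
  qed
  then obtain c where "\<And>x. x \<in> U \<Longrightarrow> ?I x = c"
    using has_vector_derivative_zero_constant[OF U(1), of ?I] by blast
  then show ?thesis using U by simp
qed

lemma integral_open_interval_lborel:
  fixes g :: "real \<Rightarrow> complex"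
  assumes "continuous_on {a..b} g"
  shows "integrable lborel (\<lambda>y. indicator {a<..<b} y *\<^sub>R g y)"
    and "(\<integral>y. indicator {a<..<b} y *\<^sub>R g y \<partial>lborel) = integral {a..b} g"
proof -
  have "set_integrable lborel {a..b} g"
    using borel_integrable_compact[of "{a..b}" g] assms by (simp add: set_integrable_def)
  then have *: "set_integrable lborel {a<..<b} g"
    by (rule set_integrable_subset) auto
  then show "integrable lborel (\<lambda>y. indicator {a<..<b} y *\<^sub>R g y)"
    by (simp add: set_integrable_def)
  from set_borel_integral_eq_integral(2)[OF *]
  show "(\<integral>y. indicator {a<..<b} y *\<^sub>R g y \<partial>lborel) = integral {a..b} g"
    by (simp add: set_lebesgue_integral_def integral_open_interval_real)
qed

lemma cis_measurable_circle:
  "cis \<in> restrict_space lborel {0..<2 * pi} \<rightarrow>\<^sub>M restrict_space borel (sphere 0 1)"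
  by (intro measurable_restrict_space2 measurable_restrict_space1)
     (auto intro!: borel_measurable_continuous_onI continuous_intros)

text \<open>For Borel \<open>h\<close> the completion is invisible, and dropping the endpoint y = 0
  changes nothing; the open interval matches the strip on which \<open>exp\<close> is
  injective.\<close>

lemma circle_measure_integral:
  fixes h :: "complex \<Rightarrow> complex"
  assumes h: "h \<in> borel_measurable (restrict_space borel (sphere 0 1))"
    and K: "compact K" "K \<subseteq> sphere 0 1"
  shows "integrable (restrict_space circle_measure K) h \<longleftrightarrow>
           integrable lborel (\<lambda>y. indicator {0<..<2*pi} y *\<^sub>R (indicator K (cis y) *\<^sub>R h (cis y)))" (is ?A)
    and "(\<integral>z. h z \<partial>restrict_space circle_measure K) =
           (\<integral>y. indicator {0<..<2*pi} y *\<^sub>R (indicator K (cis y) *\<^sub>R h (cis y)) \<partial>lborel)" (is ?B)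
proof -
  let ?N = "restrict_space borel (sphere (0::complex) 1)"
  let ?L = "restrict_space lborel {0..<2 * pi}"
  let ?h = "\<lambda>z. indicator K z *\<^sub>R h z"
  have KN: "K \<in> sets ?N"
    using K by (auto simp: sets_restrict_space image_iff Int_absorb1 intro!: borel_compact bexI[of _ K])
  have [measurable]: "?h \<in> borel_measurable ?N"
    using h KN by (intro borel_measurable_scaleR) auto
  have hd: "?h \<in> borel_measurable (distr ?L ?N cis)" by simp
  have m: "(\<lambda>y. ?h (cis y)) \<in> borel_measurable ?L"
    by (rule measurable_compose[OF cis_measurable_circle]) simp
  have KC: "K \<inter> space circle_measure \<in> sets circle_measure"
    using sets_circle_measure_compact[OF K] K by (simp add: Int_absorb2)
  have ae: "AE y in lborel. indicator {0..<2*pi} y *\<^sub>R ?h (cis y) = indicator {0<..<2*pi} y *\<^sub>R ?h (cis y)"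
    using AE_lborel_singleton[of "0::real"] by eventually_elim (auto simp: indicator_def)
  have m1: "(\<lambda>y. indicator {0..<2*pi} y *\<^sub>R ?h (cis y)) \<in> borel_measurable lborel"
    using m by (subst (asm) borel_measurable_restrict_space_iff) auto
  have m2: "(\<lambda>y. indicator {0<..<2*pi} y *\<^sub>R ?h (cis y)) \<in> borel_measurable lborel"
  proof -
    have "(\<lambda>y. indicator {0<..<2*pi} y *\<^sub>R (indicator {0..<2*pi} y *\<^sub>R ?h (cis y))) \<in> borel_measurable lborel"
      by (rule borel_measurable_scaleR[OF _ m1]) simp
    also have "(\<lambda>y. indicator {0<..<2*pi} y *\<^sub>R (indicator {0..<2*pi} y *\<^sub>R ?h (cis y))) =
      (\<lambda>y. indicator {0<..<2*pi} y *\<^sub>R ?h (cis y))"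
      by (auto simp: indicator_def fun_eq_iff)
    finally show ?thesis .
  qed
  have "integrable (restrict_space circle_measure K) h \<longleftrightarrow> integrable circle_measure ?h"
    by (rule integrable_restrict_space[OF KC])
  also have "\<dots> \<longleftrightarrow> integrable ?L (\<lambda>y. ?h (cis y))"
    unfolding circle_measure_def
    by (simp add: integrable_completion[OF hd] integrable_distr_eq[OF cis_measurable_circle])
  also have "\<dots> \<longleftrightarrow> integrable lborel (\<lambda>y. indicator {0..<2*pi} y *\<^sub>R ?h (cis y))"
    by (rule integrable_restrict_space) auto
  also have "\<dots> \<longleftrightarrow> integrable lborel (\<lambda>y. indicator {0<..<2*pi} y *\<^sub>R ?h (cis y))"
    by (rule integrable_cong_AE[OF m1 m2 ae])
  finally show ?A .
  have "(\<integral>z. h z \<partial>restrict_space circle_measure K) = (\<integral>z. ?h z \<partial>circle_measure)"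
    by (rule integral_restrict_space[OF KC])
  also have "\<dots> = (\<integral>y. ?h (cis y) \<partial>?L)"
    unfolding circle_measure_def
    by (simp add: integral_completion[OF hd] integral_distr[OF cis_measurable_circle])
  also have "\<dots> = (\<integral>y. indicator {0..<2*pi} y *\<^sub>R ?h (cis y) \<partial>lborel)"
    by (rule integral_restrict_space) auto
  also have "\<dots> = (\<integral>y. indicator {0<..<2*pi} y *\<^sub>R ?h (cis y) \<partial>lborel)"
    by (rule integral_cong_AE[OF m1 m2 ae])
  finally show ?B .
qed

lemma continuous_on_Complex: "continuous_on S (\<lambda>y. Complex x y)"
  unfolding Complex_eq by (intro continuous_intros)

section \<open>Laurent coefficients and the jump across the circle\<close>

locale sobolev_off_circle =
  fixes K :: "complex set" and f :: "complex \<Rightarrow> complex"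
  assumes compact_K: "compact K" and K_sphere: "K \<subseteq> sphere 0 1"
    and f_sobolev: "f \<in> analytic_sobolev (- K)"
begin

text \<open>Zero on K, where \<^term>\<open>deriv f\<close> has no meaning.\<close>

definition zderiv :: "complex \<Rightarrow> complex" where
  "zderiv z = (if z \<in> K then 0 else z * deriv f z)"

text \<open>For x < 0 and x > 0 this is 2 pi times the k-th Laurent coefficient of f inside and outside the
  circle, independently of x.\<close>

definition fcoeff :: "int \<Rightarrow> real \<Rightarrow> complex" where
  "fcoeff k x = integral {0..2*pi} (\<lambda>y. f (exp (Complex x y)) * exp (- of_int k * Complex x y))"

text \<open>The inner minus the outer boundary value, written without limits: the integral is f (exp 1 * z) -
  f (exp (-1) * z) unless the radius through z meets K, and then it accounts for the missing jump.\<close>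

definition jump :: "complex \<Rightarrow> complex" where
  "jump z = f (exp (-1) * z) - f (exp 1 * z) +
     (\<integral>x. indicator {-1<..<1} x *\<^sub>R zderiv (complex_of_real (exp x) * z) \<partial>lborel)"

lemma open_K: "open (- K)"
  using compact_K by (simp add: compact_imp_closed open_Compl)

lemma holo: "f holomorphic_on - K"
  using f_sobolev by (simp add: analytic_sobolev_def)

lemma notin_K: "cmod z \<noteq> 1 \<Longrightarrow> z \<notin> K"
  using K_sphere by auto

lemma exp_notin_K: "Re w \<noteq> 0 \<Longrightarrow> exp w \<notin> K"
  by (rule notin_K) simp

lemma f_DERIV: "z \<notin> K \<Longrightarrow> (f has_field_derivative deriv f z) (at z)"
  using holomorphic_derivI[OF holo open_K] by simp

lemma exp_DERIV:
  assumes "exp w \<notin> K"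
  shows "((\<lambda>w. f (exp w)) has_field_derivative zderiv (exp w)) (at w)"
  using DERIV_chain2[OF f_DERIV[OF assms] DERIV_exp] assms by (simp add: zderiv_def mult.commute)

lemma continuous_on_zderiv: "continuous_on (- K) zderiv"
proof -
  have "continuous_on (- K) (\<lambda>z. z * deriv f z)"
    by (intro continuous_intros holomorphic_on_imp_continuous_on holomorphic_deriv holo open_K)
  then show ?thesis by (rule continuous_on_eq) (simp add: zderiv_def)
qed

lemma measurable_deriv: "(\<lambda>z. indicator (- K) z *\<^sub>R deriv f z) \<in> borel_measurable borel"
  by (intro borel_measurable_continuous_on_indicator holomorphic_on_imp_continuous_on holomorphic_deriv holo open_K
      borel_open)

lemma zderiv_eq: "zderiv z = z * (indicator (- K) z *\<^sub>R deriv f z)"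
  by (simp add: zderiv_def indicator_def)

lemma measurable_zderiv [measurable]: "zderiv \<in> borel_measurable borel"
  unfolding zderiv_eq[abs_def] using measurable_deriv by measurable

lemma integrable_deriv: "integrable lborel (\<lambda>z. indicator (- K) z *\<^sub>R deriv f z)"
proof (rule integrableI_bounded)
  have "(\<integral>\<^sup>+z. ennreal (cmod (indicator (- K) z *\<^sub>R deriv f z)) \<partial>lborel) =
      (\<integral>\<^sup>+z\<in>- K. ennreal (cmod (deriv f z)) \<partial>lborel)"
    by (rule nn_integral_cong) (simp add: indicator_def)
  then show "(\<integral>\<^sup>+z. ennreal (cmod (indicator (- K) z *\<^sub>R deriv f z)) \<partial>lborel) < \<infinity>"
    using f_sobolev by (simp add: analytic_sobolev_def)
qed (use measurable_deriv in simp)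

text \<open>Of the Jacobian exp (2x), one factor exp x is absorbed by the z in z f'(z).\<close>

lemma integrable_exp_zderiv:
  "integrable (lborel \<Otimes>\<^sub>M lborel)
     (\<lambda>(x,y). indicator {0<..<2*pi} y *\<^sub>R (exp x *\<^sub>R zderiv (exp (Complex x y))))"
proof -
  let ?u = "\<lambda>x y. indicator {0<..<2*pi} y *\<^sub>R (exp (2 * x) *\<^sub>R (indicator (- K) (exp (Complex x y)) *\<^sub>R deriv f (exp (Complex x y)))) :: complex"
  have int: "integrable (lborel \<Otimes>\<^sub>M lborel) (\<lambda>(x,y). ?u x y)"
    by (rule integrable_exp_change_of_variables[OF integrable_deriv])
  have m: "(\<lambda>(x,y). indicator {0<..<2*pi} y *\<^sub>R (exp x *\<^sub>R zderiv (exp (Complex x y)))) \<in> borel_measurable (lborel \<Otimes>\<^sub>M lborel)"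
    by measurable
  show ?thesis
  proof (rule Bochner_Integration.integrable_bound[OF int m], rule AE_I2, clarify)
    fix x y :: real
    have "cmod (exp (Complex x y)) = exp x" by simp
    moreover have "exp (2 * x) = exp x * exp x" by (simp flip: exp_add)
    ultimately show "cmod (indicator {0<..<2*pi} y *\<^sub>R (exp x *\<^sub>R zderiv (exp (Complex x y)))) \<le> cmod (?u x y)"
      by (simp only: zderiv_eq norm_mult norm_scaleR) (simp add: norm_mult)
  qed
qed

text \<open>Every use of Fubini below rests on this. A bounded weight supported in x > -1 qualifies,
  at the cost of a factor exp 1 where x is negative.\<close>

lemma integrable_zderiv_weight:
  assumes w: "case_prod w \<in> borel_measurable (lborel \<Otimes>\<^sub>M lborel)"
    and B: "\<And>x y. cmod (w x y) \<le> B * exp x"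
  shows "integrable (lborel \<Otimes>\<^sub>M lborel)
     (\<lambda>(x,y). indicator {0<..<2*pi} y *\<^sub>R (w x y * zderiv (exp (Complex x y))))"
proof -
  have int: "integrable (lborel \<Otimes>\<^sub>M lborel)
     (\<lambda>p. B *\<^sub>R (\<lambda>(x,y). indicator {0<..<2*pi} y *\<^sub>R (exp x *\<^sub>R zderiv (exp (Complex x y)))) p)"
    using integrable_exp_zderiv by (rule integrable_scaleR_right)
  have "(\<lambda>p. indicator {0<..<2*pi} (snd p) *\<^sub>R (case_prod w p * zderiv (exp (Complex (fst p) (snd p)))))
      \<in> borel_measurable (lborel \<Otimes>\<^sub>M lborel)"
  proof (intro borel_measurable_scaleR borel_measurable_times w)
    show "(\<lambda>p. zderiv (exp (Complex (fst p) (snd p)))) \<in> borel_measurable (lborel \<Otimes>\<^sub>M lborel)"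
      by measurable
  qed measurable
  then have m: "(\<lambda>(x,y). indicator {0<..<2*pi} y *\<^sub>R (w x y * zderiv (exp (Complex x y)))) \<in> borel_measurable (lborel \<Otimes>\<^sub>M lborel)"
    by (simp add: case_prod_unfold)
  show ?thesis
  proof (rule Bochner_Integration.integrable_bound[OF int m], rule AE_I2, clarify)
    fix x y :: real
    have "cmod (w x y) \<le> \<bar>B\<bar> * exp x"
      using B[of x y] mult_right_mono[OF abs_ge_self[of B] exp_ge_zero[of x]] by linarith
    then have "indicator {0<..<2*pi} y * (cmod (w x y) * cmod (zderiv (exp (Complex x y)))) \<le>
        indicator {0<..<2*pi} y * ((\<bar>B\<bar> * exp x) * cmod (zderiv (exp (Complex x y))))"
      by (intro mult_left_mono mult_right_mono) auto
    then show "cmod (indicator {0<..<2*pi} y *\<^sub>R (w x y * zderiv (exp (Complex x y)))) \<le>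
      norm (B *\<^sub>R (indicator {0<..<2*pi} y *\<^sub>R (exp x *\<^sub>R zderiv (exp (Complex x y)))))"
      by (simp add: norm_mult abs_mult mult_ac)
  qed
qed

lemma fcoeff_DERIV:
  assumes "exp w \<notin> K"
  shows "((\<lambda>w. f (exp w) * exp (- of_int k * w)) has_field_derivative
     zderiv (exp w) * exp (- of_int k * w) - of_int k * (f (exp w) * exp (- of_int k * w))) (at w)"
  by (rule derivative_eq_intros exp_DERIV[OF assms] refl)+ (simp add: algebra_simps)

lemma exp_periodic: "exp (w + 2 * pi * \<i>) = exp w" "exp (- of_int k * (w + 2 * pi * \<i>)) = exp (- of_int k * w)"
proof -
  have "exp (complex_of_int (-k) * (2 * pi * \<i>)) = 1"
    using exp_integer_2pi[of "of_int (-k)"] by (simp add: algebra_simps)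
  then show "exp (- of_int k * (w + 2 * pi * \<i>)) = exp (- of_int k * w)"
    by (simp add: distrib_left exp_add exp_minus exp_diff)
qed (simp add: exp_add)

lemma continuous_on_exp_f: "x \<noteq> 0 \<Longrightarrow> continuous_on S (\<lambda>y. f (exp (Complex x y)))"
  by (rule continuous_on_compose2[OF holomorphic_on_imp_continuous_on[OF holo]])
     (auto simp: exp_notin_K intro!: continuous_on_exp continuous_on_Complex)

lemma continuous_on_exp_zderiv: "x \<noteq> 0 \<Longrightarrow> continuous_on S (\<lambda>y. zderiv (exp (Complex x y)))"
  by (rule continuous_on_compose2[OF continuous_on_zderiv])
     (auto simp: exp_notin_K intro!: continuous_on_exp continuous_on_Complex)

text \<open>Integration by parts over one period: differentiating f(exp w) in w multiplies its k-th
  coefficient by k.\<close>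

lemma integral_zderiv:
  assumes "x \<noteq> 0"
  shows "integral {0..2*pi} (\<lambda>y. zderiv (exp (Complex x y)) * exp (- of_int k * Complex x y)) = of_int k * fcoeff k x"
proof -
  let ?e = "\<lambda>y. exp (- of_int k * Complex x y)"
  have cont: "continuous_on {0..2*pi} ?e"
    by (intro continuous_intros continuous_on_Complex)
  let ?g = "\<lambda>y. of_int k * (f (exp (Complex x y)) * ?e y)"
  have 0: "((\<lambda>y. zderiv (exp (Complex x y)) * ?e y - ?g y) has_integral 0) {0..2*pi}"
  proof (rule periodic_has_integral_deriv[OF fcoeff_DERIV])
    show "exp (Complex x y) \<notin> K" for y using assms by (intro exp_notin_K) simp
    have "Complex x (2 * pi) = Complex x 0 + 2 * pi * \<i>" by (simp add: complex_eq_iff)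
    then show "f (exp (Complex x (2 * pi))) * exp (- of_int k * Complex x (2 * pi)) =
        f (exp (Complex x 0)) * exp (- of_int k * Complex x 0)"
      by (simp only: exp_periodic)
  qed
  have "?g integrable_on {0..2*pi}"
    by (intro integrable_continuous_real continuous_on_mult continuous_on_const cont continuous_on_exp_f assms)
  from has_integral_add[OF 0 integrable_integral[OF this]]
  show ?thesis
    by (simp add: fcoeff_def integral_unique)
qed

text \<open>The hypothesis puts both vertical lines on the same side of the imaginary axis, in a
  half-plane that \<open>exp\<close> maps off the circle.\<close>

lemma fcoeff_const:
  assumes "x * x' > 0"
  shows "fcoeff k x = fcoeff k x'"
proof -
  define U where "U = {t::real. t * x > 0}"
  have U: "U = {0<..} \<or> U = {..<0}"
    using assms by (auto simp: U_def zero_less_mult_iff)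
  show ?thesis unfolding fcoeff_def
  proof (rule periodic_integral_constant[OF fcoeff_DERIV[OF exp_notin_K]])
    show "convex U" using U by auto
    show "x \<in> U" "x' \<in> U" using assms by (auto simp: U_def zero_less_mult_iff)
    have sub: "exp ` {w. Re w \<in> U} \<subseteq> - K" using U exp_notin_K by auto
    have "continuous_on {w. Re w \<in> U} (\<lambda>w. zderiv (exp w))" "continuous_on {w. Re w \<in> U} (\<lambda>w. f (exp w))"
      by (rule continuous_on_compose2[OF continuous_on_zderiv _ sub] continuous_on_compose2[OF holomorphic_on_imp_continuous_on[OF holo] _ sub];
        intro continuous_intros)+
    then show "continuous_on {w. Re w \<in> U} (\<lambda>w. zderiv (exp w) * exp (- of_int k * w) - of_int k * (f (exp w) * exp (- of_int k * w)))"
      by (intro continuous_intros)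
    show "f (exp (w + 2 * pi * \<i>)) * exp (- of_int k * (w + 2 * pi * \<i>)) = f (exp w) * exp (- of_int k * w)" for w
      by (simp only: exp_periodic)
  qed (use U in auto)
qed

end

lemma exp_Complex: "exp (Complex x y) = complex_of_real (exp x) * cis y"
  by (simp add: exp_eq_polar)

lemma exp_Complex_int: "exp (- of_int k * Complex x y) = complex_of_real (exp (- of_int k * x)) * cis (- of_int k * y)"
  by (simp add: exp_eq_polar)

text \<open>Cauchy's formula on the circle of radius exp (-1), that is on the line x = -1, where dz
  / z = i dy.\<close>

lemma circle_coefficient:
  fixes g :: "complex \<Rightarrow> complex"
  assumes g: "g holomorphic_on ball 0 1"
  shows "integral {0..2*pi} (\<lambda>y. g (exp (Complex (-1) y)) * exp (- of_int (int n) * Complex (-1) y)) =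
    2 * pi / fact n * (deriv ^^ n) g 0"
proof -
  let ?r = "exp (-1) :: real"
  have r: "?r < 1" by simp
  have "((\<lambda>u. g u / (u - 0) ^ Suc n) has_contour_integral 2 * pi * \<i> / fact n * (deriv ^^ n) g 0) (circlepath 0 ?r)"
    by (rule Cauchy_has_contour_integral_higher_derivative_circlepath)
      (use r in \<open>auto intro!: holomorphic_on_imp_continuous_on holomorphic_on_subset[OF g] simp del: exp_less_one_iff\<close>)
  then have "((\<lambda>t. g (?r * cis t) / (?r * cis t) ^ Suc n * ?r * \<i> * cis t) has_integral
      2 * pi * \<i> / fact n * (deriv ^^ n) g 0) {0..2*pi}"
    unfolding circlepath_def by (subst (asm) has_contour_integral_part_circlepath_iff) simp_all
  also have "(\<lambda>t. g (?r * cis t) / (?r * cis t) ^ Suc n * ?r * \<i> * cis t) =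
    (\<lambda>y. \<i> * (g (exp (Complex (-1) y)) * exp (- of_int (int n) * Complex (-1) y)))"
  proof
    fix t
    have "exp (- of_int (int n) * Complex (-1) t) = inverse ((?r * cis t) ^ n)"
      by (simp add: exp_minus exp_of_nat_mult exp_Complex)
    then show "g (?r * cis t) / (?r * cis t) ^ Suc n * ?r * \<i> * cis t =
      \<i> * (g (exp (Complex (-1) t)) * exp (- of_int (int n) * Complex (-1) t))"
      by (simp add: exp_Complex field_simps)
  qed
  finally have "((\<lambda>y. \<i> * (g (exp (Complex (-1) y)) * exp (- of_int (int n) * Complex (-1) y))) has_integral
    2 * pi * \<i> / fact n * (deriv ^^ n) g 0) {0..2*pi}" .
  from has_integral_mult_right[OF this, of "-\<i>"] show ?thesis
    by (simp add: integral_unique field_simps)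
qed

text \<open>The factor exp (k x) is independent of y, so a Fourier coefficient on any vertical line
  is a multiple of \<open>fcoeff\<close> there.\<close>

lemma cis_exp_Complex:
  "cis (- of_int k * y) = complex_of_real (exp (of_int k * x)) * exp (- of_int k * Complex x y)"
proof -
  have "complex_of_real (exp (of_int k * x)) * exp (- of_int k * Complex x y) =
      complex_of_real (exp (of_int k * x) * exp (- of_int k * x)) * cis (- of_int k * y)"
    unfolding exp_Complex_int of_real_mult by (simp only: mult.assoc)
  also have "exp (of_int k * x) * exp (- of_int k * x) = 1" by (simp flip: exp_add)
  finally show ?thesis by simp
qed

text \<open>The factor k stays in the integrand so that k = 0 needs no separate case.\<close>

lemma integral_exp_interval:
  fixes c :: complex and k a b :: real
  assumes "a \<le> b"
  shows "integrable lborel (\<lambda>x. indicator {a<..<b} x *\<^sub>R (of_real k * c * of_real (exp (k * x))))" (is ?A)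
    and "(\<integral>x. indicator {a<..<b} x *\<^sub>R (of_real k * c * of_real (exp (k * x))) \<partial>lborel) =
      c * (of_real (exp (k * b)) - of_real (exp (k * a)))" (is ?B)
proof -
  have "((\<lambda>x. c * of_real (exp (k * x))) has_vector_derivative of_real k * c * of_real (exp (k * x))) (at x within {a..b})" for x
    by (auto intro!: derivative_eq_intros has_vector_derivative_of_real simp: has_real_derivative_iff_has_vector_derivative[symmetric])
  from fundamental_theorem_of_calculus[OF assms this]
  have "integral {a..b} (\<lambda>x. of_real k * c * of_real (exp (k * x))) = c * (of_real (exp (k * b)) - of_real (exp (k * a)))"
    by (simp only: right_diff_distrib integral_unique)
  moreover have cont: "continuous_on {a..b} (\<lambda>x. of_real k * c * complex_of_real (exp (k * x)))"
    by (intro continuous_intros)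
  ultimately show ?A ?B
    by (simp_all only: integral_open_interval_lborel)
qed

context sobolev_off_circle
begin

lemma holo_ball: "f holomorphic_on ball 0 1"
  by (rule holomorphic_on_subset[OF holo]) (use notin_K in fastforce)

lemma fcoeff_inner: "fcoeff (int n) (-1) = 2 * pi / fact n * (deriv ^^ n) f 0"
  unfolding fcoeff_def by (rule circle_coefficient[OF holo_ball])

lemma fcoeff_inner_negative: "fcoeff (- int (Suc n)) (-1) = 0"
proof -
  \<comment> \<open>Multiplying by u^(n+1) moves the coefficient to index 0, where it is a multiple
    of the product's value at the origin, hence 0.\<close>
  have "(\<lambda>u. f u * u ^ Suc n) holomorphic_on ball 0 1"
    by (intro holomorphic_intros holo_ball)
  from circle_coefficient[OF this, of 0]
  have "integral {0..2*pi} (\<lambda>y. f (exp (Complex (-1) y)) * exp (Complex (-1) y) ^ Suc n) = 0"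
    by simp
  moreover have "exp (Complex (-1) y) ^ Suc n = exp (- of_int (- int (Suc n)) * Complex (-1) y)" for y
    by (subst exp_of_nat_mult[symmetric]) (simp add: add.commute)
  ultimately show ?thesis unfolding fcoeff_def by simp
qed

lemma integral_zderiv_lborel:
  assumes "x \<noteq> 0"
  shows "(\<integral>y. indicator {0<..<2*pi} y *\<^sub>R (zderiv (exp (Complex x y)) * exp (- of_int k * Complex x y)) \<partial>lborel) = of_int k * fcoeff k x"
proof -
  have "continuous_on {0..2*pi} (\<lambda>y. zderiv (exp (Complex x y)) * exp (- of_int k * Complex x y))"
    by (intro continuous_on_mult continuous_on_exp_zderiv continuous_on_exp continuous_on_Complex
       continuous_on_const assms)
  from integral_open_interval_lborel(2)[OF this] show ?thesis
    by (simp only: integral_zderiv[OF assms])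
qed

text \<open>On each line x > 0 the n-th coefficient of z f'(z) is the constant n times
  \<open>fcoeff n 1\<close>. Since |exp (-n w)| \<le> exp x there, Fubini makes this constant
  integrable over a half-line, so it is 0.\<close>

lemma fcoeff_outer_positive:
  assumes "n > 0"
  shows "fcoeff (int n) 1 = 0"
proof (rule ccontr)
  assume nz: "fcoeff (int n) 1 \<noteq> 0"
  define w :: "real \<Rightarrow> real \<Rightarrow> complex" where
    "w x y = indicator {0<..} x *\<^sub>R exp (- of_int (int n) * Complex x y)" for x y
  have w: "case_prod w \<in> borel_measurable (lborel \<Otimes>\<^sub>M lborel)"
    unfolding w_def by measurable
  have B: "cmod (w x y) \<le> 1 * exp x" for x y
  proof -
    have "- (real n * x) \<le> x" if "x > 0"
      using mult_nonneg_nonneg[of "real n" x] that by linarith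
    then show ?thesis by (auto simp: w_def indicator_def)
  qed
  have eq: "(\<integral>y. indicator {0<..<2*pi} y *\<^sub>R (w x y * zderiv (exp (Complex x y))) \<partial>lborel) =
      indicator {0<..} x *\<^sub>R (of_int (int n) * fcoeff (int n) 1)" for x
  proof (cases "x > 0")
    case True
    have "(\<integral>y. indicator {0<..<2*pi} y *\<^sub>R (w x y * zderiv (exp (Complex x y))) \<partial>lborel) = of_int (int n) * fcoeff (int n) x"
      using integral_zderiv_lborel[of x "int n"] True by (simp add: w_def mult.commute)
    then show ?thesis using fcoeff_const[of x 1] True by simp
  qed (simp add: w_def)
  have "integrable lborel (\<lambda>x. \<integral>y. indicator {0<..<2*pi} y *\<^sub>R (w x y * zderiv (exp (Complex x y))) \<partial>lborel)"
    by (rule lborel_pair.integrable_fst[OF integrable_zderiv_weight[OF w B]])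
  then have "integrable lborel (\<lambda>x::real. indicator {0<..} x *\<^sub>R (of_int (int n) * fcoeff (int n) 1))"
    unfolding eq .
  from integrable_norm[OF this]
  have "integrable lborel (\<lambda>x::real. indicator {0<..} x * cmod (of_int (int n) * fcoeff (int n) 1))"
    by simp
  then have "integrable lborel (indicator {0<..} :: real \<Rightarrow> real)"
    using nz assms by (simp add: norm_mult)
  then have fin: "emeasure lborel {0::real<..} < \<infinity>"
    by (simp add: integrable_indicator_iff)
  show False
  proof -
    obtain r where r: "r \<ge> 0" "emeasure lborel {0::real<..} = ennreal r"
      using fin by (metis ennreal_cases less_irrefl infinity_ennreal_def)
    have "emeasure lborel {0<..<r+1} \<le> emeasure lborel {0::real<..}"
      by (intro emeasure_mono) auto
    then show False using r by (simp add: ennreal_le_iff)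
  qed
qed

lemma exp_times_notin_K:
  assumes "cmod z = 1" "z \<notin> K"
  shows "complex_of_real (exp x) * z \<notin> K"
  using assms by (cases "x = 0") (auto intro!: notin_K simp: norm_mult)

text \<open>The whole radial segment through z avoids \<open>K\<close>, since only z itself lies on
  the circle; the fundamental theorem then evaluates the integral.\<close>

lemma jump_zero:
  assumes z: "cmod z = 1" "z \<notin> K"
  shows "jump z = 0"
proof -
  have cont: "continuous_on {-1..1} (\<lambda>x. zderiv (complex_of_real (exp x) * z))"
    by (rule continuous_on_compose2[OF continuous_on_zderiv])
      (use exp_times_notin_K[OF z] in \<open>auto intro!: continuous_intros simp del: of_real_exp\<close>)
  have "((\<lambda>x. f (complex_of_real (exp x) * z)) has_vector_derivative zderiv (complex_of_real (exp x) * z)) (at x within {-1..1})" for x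
  proof -
    let ?z = "complex_of_real (exp x) * z"
    have "((\<lambda>x. complex_of_real (exp x) * z) has_vector_derivative ?z) (at x within {-1..1})"
      by (auto intro!: derivative_eq_intros has_vector_derivative_of_real simp: has_real_derivative_iff_has_vector_derivative[symmetric])
    from field_vector_diff_chain_within[OF this has_field_derivative_at_within[OF f_DERIV[OF exp_times_notin_K[OF z]]]]
    show ?thesis using exp_times_notin_K[OF z] by (simp add: o_def zderiv_def)
  qed
  from fundamental_theorem_of_calculus[OF _ this]
  have "integral {-1..1} (\<lambda>x. zderiv (complex_of_real (exp x) * z)) = f (exp 1 * z) - f (exp (-1) * z)"
    by (simp add: integral_unique of_real_exp)
  then show ?thesis
    unfolding jump_def integral_open_interval_lborel(2)[OF cont] by simp
qed

lemma measurable_jump: "jump \<in> borel_measurable (restrict_space borel (sphere 0 1))"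
proof -
  have c: "(\<lambda>z. f (exp (of_real a) * z)) \<in> borel_measurable (restrict_space borel (sphere 0 1))" if "a \<noteq> 0" for a :: real
  proof (rule borel_measurable_continuous_on_restrict, rule continuous_on_compose2[OF holomorphic_on_imp_continuous_on[OF holo]])
    have "exp (of_real a) * z \<notin> K" if "cmod z = 1" for z
      using that \<open>a \<noteq> 0\<close> by (intro notin_K) (simp add: norm_mult)
    then show "(\<lambda>z. exp (of_real a) * z) ` sphere 0 1 \<subseteq> - K" by auto
  qed (intro continuous_intros)
  have "(\<lambda>z. \<integral>x. indicator {-1<..<1} x *\<^sub>R zderiv (complex_of_real (exp x) * z) \<partial>lborel) \<in> borel_measurable borel"
    by measurable
  then have "(\<lambda>z. \<integral>x. indicator {-1<..<1} x *\<^sub>R zderiv (complex_of_real (exp x) * z) \<partial>lborel) \<in>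
      borel_measurable (restrict_space borel (sphere 0 1))"
    by (rule measurable_restrict_space1)
  then show ?thesis
    using c[of "-1"] c[of 1] unfolding jump_def[abs_def] by simp
qed

text \<open>Write d and c for \<open>fcoeff k (-1)\<close> and \<open>fcoeff k 1\<close>. By Fubini
  the radial integral contributes d (1 - exp (-k)) + c (exp k - 1); the values of f on the circles
  of radii exp (-1) and exp 1 contribute exp (-k) d - exp k c. The exponentials cancel.\<close>

lemma jump_coefficient:
  shows "integrable lborel (\<lambda>y. indicator {0<..<2*pi} y *\<^sub>R (jump (cis y) * cis (- of_int k * y)))"
    and "(\<integral>y. indicator {0<..<2*pi} y *\<^sub>R (jump (cis y) * cis (- of_int k * y)) \<partial>lborel) = fcoeff k (-1) - fcoeff k 1"
proof -
  let ?k = "real_of_int k"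
  let ?e = "\<lambda>y. cis (- ?k * y)"
  define w :: "real \<Rightarrow> real \<Rightarrow> complex" where "w x y = indicator {-1<..<1} x *\<^sub>R ?e y" for x y
  define g where "g x y = indicator {0<..<2*pi} y *\<^sub>R (w x y * zderiv (exp (Complex x y)))" for x y
  have [measurable]: "?e \<in> borel_measurable borel"
    by (intro borel_measurable_continuous_onI continuous_intros)
  have w: "case_prod w \<in> borel_measurable (lborel \<Otimes>\<^sub>M lborel)"
    unfolding w_def by measurable
  have B: "cmod (w x y) \<le> exp 1 * exp x" for x y
    by (auto simp: w_def indicator_def simp flip: exp_add)
  have g: "integrable (lborel \<Otimes>\<^sub>M lborel) (case_prod g)"
    unfolding g_def by (rule integrable_zderiv_weight[OF w B])

  define S where "S y = (\<integral>x. indicator {-1<..<1} x *\<^sub>R zderiv (complex_of_real (exp x) * cis y) \<partial>lborel)" for y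
  have gS: "(\<integral>x. g x y \<partial>lborel) = indicator {0<..<2*pi} y *\<^sub>R (S y * ?e y)" for y
  proof -
    have "g x y = (indicator {0<..<2*pi} y *\<^sub>R ?e y) * (indicator {-1<..<1} x *\<^sub>R zderiv (complex_of_real (exp x) * cis y))" for x
      by (simp add: g_def w_def exp_Complex)
    then have "(\<integral>x. g x y \<partial>lborel) = (indicator {0<..<2*pi} y *\<^sub>R ?e y) * S y"
      by (simp only: integral_mult_right_zero S_def)
    then show ?thesis by simp
  qed
  have S_int: "integrable lborel (\<lambda>y. indicator {0<..<2*pi} y *\<^sub>R (S y * ?e y))"
    using lborel_pair.integrable_snd[OF g] by (simp only: gS)
  have "(\<integral>y. indicator {0<..<2*pi} y *\<^sub>R (S y * ?e y) \<partial>lborel) = (\<integral>x. (\<integral>y. g x y \<partial>lborel) \<partial>lborel)"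
    using lborel_pair.Fubini_integral[OF g] by (simp only: gS)
  also have "\<dots> = (\<integral>x. indicator {-1<..<0} x *\<^sub>R (?k * fcoeff k (-1) * exp (?k * x)) + indicator {0<..<1} x *\<^sub>R (?k * fcoeff k 1 * exp (?k * x)) \<partial>lborel)"
  proof (rule integral_cong_AE)
    show "(\<lambda>x. \<integral>y. g x y \<partial>lborel) \<in> borel_measurable lborel"
      using lborel_pair.integrable_fst[OF g] by simp
    show "AE x in lborel. (\<integral>y. g x y \<partial>lborel) =
      indicator {-1<..<0} x *\<^sub>R (?k * fcoeff k (-1) * exp (?k * x)) + indicator {0<..<1} x *\<^sub>R (?k * fcoeff k 1 * exp (?k * x))"
      using AE_lborel_singleton[of "0::real"]
    proof eventually_elim
      case (elim x)
      have "g x y = (indicator {-1<..<1} x *\<^sub>R complex_of_real (exp (?k * x))) *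
        (indicator {0<..<2*pi} y *\<^sub>R (zderiv (exp (Complex x y)) * exp (- of_int k * Complex x y)))" for y
        unfolding g_def w_def cis_exp_Complex[of k _ x] by (simp only: mult_scaleR_left mult_scaleR_right scaleR_scaleR mult_ac)
      then have "(\<integral>y. g x y \<partial>lborel) = (indicator {-1<..<1} x *\<^sub>R complex_of_real (exp (?k * x))) * (of_int k * fcoeff k x)"
        by (simp only: integral_mult_right_zero integral_zderiv_lborel[OF elim])
      moreover have "fcoeff k x = (if x < 0 then fcoeff k (-1) else fcoeff k 1)"
        using fcoeff_const[of x "-1" k] fcoeff_const[of x 1 k] elim by auto
      ultimately show ?case using elim
        by (auto simp: indicator_def)
    qed
  qed measurable
  also have "\<dots> = fcoeff k (-1) * (1 - exp (- ?k)) + fcoeff k 1 * (exp ?k - 1)"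
  proof -
    have "exp (- ?k) = exp (?k * - 1)" "exp ?k = exp (?k * 1)" "1 = exp (?k * 0)" by auto
    then show ?thesis
      using integral_exp_interval[of "-1" 0 ?k "fcoeff k (-1)"] integral_exp_interval[of 0 1 ?k "fcoeff k 1"]
      by (subst Bochner_Integration.integral_add) (simp_all only: of_real_of_int_eq zero_le_one neg_le_0_iff_le
          of_real_exp of_real_diff simp_thms of_real_1 mult_zero_right exp_zero)
  qed
  finally have S_val: "(\<integral>y. indicator {0<..<2*pi} y *\<^sub>R (S y * ?e y) \<partial>lborel) =
    fcoeff k (-1) * (1 - exp (- ?k)) + fcoeff k 1 * (exp ?k - 1)" .

  define P where "P a y = indicator {0<..<2*pi} y *\<^sub>R (f (exp (complex_of_real a) * cis y) * ?e y)" for a y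
  have P: "integrable lborel (P a)" "(\<integral>y. P a y \<partial>lborel) = exp (?k * a) * fcoeff k a" if "a \<noteq> 0" for a
  proof -
    let ?h = "\<lambda>y. f (exp (Complex a y)) * exp (- of_int k * Complex a y)"
    have cont: "continuous_on {0..2*pi} ?h"
      by (intro continuous_on_mult continuous_on_exp_f continuous_on_exp continuous_on_Complex
       continuous_on_const that)
    have eq: "P a = (\<lambda>y. exp (?k * a) * (indicator {0<..<2*pi} y *\<^sub>R ?h y))"
      unfolding P_def exp_Complex cis_exp_Complex[of k _ a] of_real_exp
      by (simp only: mult_scaleR_left mult_scaleR_right scaleR_scaleR mult_ac)
    show "integrable lborel (P a)" unfolding eq
      by (intro integrable_mult_right integral_open_interval_lborel cont)
    show "(\<integral>y. P a y \<partial>lborel) = exp (?k * a) * fcoeff k a"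
      unfolding eq fcoeff_def integral_mult_right_zero integral_open_interval_lborel(2)[OF cont] by (rule refl)
  qed
  have split: "(\<lambda>y. indicator {0<..<2*pi} y *\<^sub>R (jump (cis y) * ?e y)) =
      (\<lambda>y. P (-1) y - P 1 y + indicator {0<..<2*pi} y *\<^sub>R (S y * ?e y))"
    by (auto simp: fun_eq_iff P_def S_def jump_def indicator_def algebra_simps)
  show "integrable lborel (\<lambda>y. indicator {0<..<2*pi} y *\<^sub>R (jump (cis y) * ?e y))"
    unfolding split using P S_int by auto
  have "(\<integral>y. indicator {0<..<2*pi} y *\<^sub>R (jump (cis y) * ?e y) \<partial>lborel) =
      exp (- ?k) * fcoeff k (-1) - exp ?k * fcoeff k 1 + (fcoeff k (-1) * (1 - exp (- ?k)) + fcoeff k 1 * (exp ?k - 1))"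
    unfolding split using P(1)[of "-1"] P(2)[of "-1"] P(1)[of 1] P(2)[of 1] S_int S_val by simp
  then show "(\<integral>y. indicator {0<..<2*pi} y *\<^sub>R (jump (cis y) * ?e y) \<partial>lborel) = fcoeff k (-1) - fcoeff k 1"
    by (simp add: algebra_simps)
qed

end

section \<open>The Green formula\<close>

text \<open>The value is 1/a - 1/(a + 2); with a = 2m + 2 it supplies both denominators of the
  monomial case.\<close>

lemma integral_exp_diff_halfline:
  assumes "a > 0"
  shows "(\<integral>x. indicator {0..} x *\<^sub>R complex_of_real ((1 - exp (- 2 * x)) * exp (- a * x)) \<partial>lborel) = of_real (2 / (a * (a + 2)))"
proof -
  let ?h = "\<lambda>x::real. (1 - exp (- 2 * x)) * exp (- a * x)"
  have "((\<lambda>x. exp (- a * x) - exp (- (a + 2) * x)) has_integral exp (- a * 0) / a - exp (- (a + 2) * 0) / (a + 2)) {0..}"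
    using assms by (intro has_integral_diff has_integral_exp_minus_to_infinity) auto
  also have "(\<lambda>x. exp (- a * x) - exp (- (a + 2) * x)) = ?h"
    by (auto simp: fun_eq_iff algebra_simps simp flip: exp_add)
  also have "exp (- a * 0) / a - exp (- (a + 2) * 0) / (a + 2) = 2 / (a * (a + 2))"
    using assms by (simp add: field_simps)
  finally have hi: "(?h has_integral 2 / (a * (a + 2))) {0..}" .
  then have "?h absolutely_integrable_on {0..}"
    by (intro nonnegative_absolutely_integrable_1) (auto simp: has_integral_iff)
  from set_lebesgue_integral_eq_integral(2)[OF this] hi
  have "(\<integral>x. indicator {0..} x *\<^sub>R ?h x \<partial>lebesgue) = 2 / (a * (a + 2))"
    by (simp add: set_lebesgue_integral_def has_integral_iff)
  then have "(\<integral>x. indicator {0..} x *\<^sub>R ?h x \<partial>lborel) = 2 / (a * (a + 2))"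
    by (subst (asm) integral_completion) simp_all
  moreover have "indicator {0..} x *\<^sub>R complex_of_real (?h x) = complex_of_real (indicator {0..} x *\<^sub>R ?h x)" for x
    by (simp add: scaleR_conv_of_real)
  ultimately show ?thesis by (simp only: integral_complex_of_real)
qed

lemma poly_eq_sum:
  fixes p :: "'a::comm_semiring_1 poly"
  assumes "degree p \<le> n"
  shows "poly p x = (\<Sum>i\<le>n. coeff p i * x ^ i)"
  unfolding poly_altdef
  by (rule sum.mono_neutral_left) (use assms in \<open>auto simp: coeff_eq_0\<close>)

context sobolev_off_circle
begin

text \<open>In the coordinate x + iy the outer variable is exp (x + iy) and its reflection in the circle is
  exp (-x + iy), so that exp (-x) plays the role of |z| in the Bloch weight.\<close>

definition green_weight :: "complex poly \<Rightarrow> real \<Rightarrow> real \<Rightarrow> complex" where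
  "green_weight P x y = indicator {0..} x *\<^sub>R
     (complex_of_real (1 - exp (- 2 * x)) * poly P (complex_of_real (exp (- x)) * cis y) * cis (2 * y))"

lemma green_weight_measurable: "case_prod (green_weight P) \<in> borel_measurable (lborel \<Otimes>\<^sub>M lborel)"
proof -
  have [measurable]: "poly P \<in> borel_measurable borel" "cis \<in> borel_measurable borel"
    by (intro borel_measurable_continuous_onI continuous_intros)+
  show ?thesis unfolding green_weight_def by measurable
qed

lemma green_weight_bound: "\<exists>B. \<forall>x y. cmod (green_weight P x y) \<le> B * exp x"
proof -
  have "bounded (poly P ` cball 0 1)"
    by (intro compact_imp_bounded compact_continuous_image continuous_intros) auto
  then obtain B where B: "\<And>z. cmod z \<le> 1 \<Longrightarrow> cmod (poly P z) \<le> B"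
    by (force simp: bounded_iff)
  have B0: "B \<ge> 0" using order_trans[OF norm_ge_zero B[of 0]] by simp
  have "cmod (green_weight P x y) \<le> B * exp x" for x y
  proof (cases "x \<ge> 0")
    case True
    have "cmod (green_weight P x y) = \<bar>1 - exp (- 2 * x)\<bar> * cmod (poly P (complex_of_real (exp (- x)) * cis y))"
      using True unfolding green_weight_def by (simp add: norm_mult del: of_real_diff)
    also have "\<dots> \<le> 1 * B"
      using True by (intro mult_mono B) (auto simp: norm_mult)
    also have "\<dots> \<le> B * exp x" using B0 True by (simp add: mult_le_cancel_left1)
    finally show ?thesis .
  qed (simp add: green_weight_def B0)
  then show ?thesis by blast
qed

lemma integrable_green_weight:
  "integrable (lborel \<Otimes>\<^sub>M lborel) (\<lambda>(x,y). indicator {0<..<2*pi} y *\<^sub>R (green_weight P x y * zderiv (exp (Complex x y))))"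
  using green_weight_bound[of P] integrable_zderiv_weight[OF green_weight_measurable[of P]] by blast

text \<open>With \<zeta> = exp (x + iy) this is the integral over |\<zeta>| > 1 of (1 -
  |\<zeta>|^-2) P(1 / conj \<zeta>) (\<zeta> / |\<zeta>|)^2 \<zeta> f'(\<zeta>) |\<zeta>|^-2 dA. The
  squared phase raises the frequency by two: one for the z in the pairing, one for the degree lost
  in Q'.\<close>

definition green_integral :: "complex poly \<Rightarrow> complex" where
  "green_integral P = (\<integral>(x,y). indicator {0<..<2*pi} y *\<^sub>R (green_weight P x y * zderiv (exp (Complex x y))) \<partial>(lborel \<Otimes>\<^sub>M lborel))"

text \<open>The phase selects the exterior coefficient of index -(m + 2). The decay exp (-(2m + 2)
  x) combines exp (-m x) from the monomial with exp (-(m + 2) x), which offsets the growth of exp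
  (-k w).\<close>

lemma green_integral_monom: "green_integral (monom 1 m) = - fcoeff (- int (m + 2)) 1 / (2 * of_nat (m + 1))"
proof -
  let ?k = "- int (m + 2)"
  have inner: "(\<integral>y. indicator {0<..<2*pi} y *\<^sub>R (green_weight (monom 1 m) x y * zderiv (exp (Complex x y))) \<partial>lborel) =
      indicator {0..} x *\<^sub>R complex_of_real ((1 - exp (- 2 * x)) * exp (- (2 * real m + 2) * x)) * (of_int ?k * fcoeff ?k 1)" for x
  proof (cases "x > 0")
    case True
    have "indicator {0<..<2*pi} y *\<^sub>R (green_weight (monom 1 m) x y * zderiv (exp (Complex x y))) =
      complex_of_real ((1 - exp (- 2 * x)) * exp (- (2 * real m + 2) * x)) *
      (indicator {0<..<2*pi} y *\<^sub>R (zderiv (exp (Complex x y)) * exp (- of_int ?k * Complex x y)))" for y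
    proof -
      have "(complex_of_real (exp (- x)) * cis y) ^ m * cis (2 * y) = complex_of_real (exp (- m * x)) * cis (- of_int ?k * y)"
        by (simp add: power_mult_distrib Complex.DeMoivre cis_mult algebra_simps flip: of_real_power exp_of_nat_mult of_real_exp)
      also have "\<dots> = complex_of_real (exp (- m * x) * exp (of_int ?k * x)) * exp (- of_int ?k * Complex x y)"
        unfolding cis_exp_Complex[of _ y x] of_real_mult by (simp only: mult.assoc)
      also have "exp (- m * x) * exp (of_int ?k * x) = exp (- (2 * real m + 2) * x)"
        by (simp add: algebra_simps flip: exp_add)
      finally have e: "(complex_of_real (exp (- x)) * cis y) ^ m * cis (2 * y) =
        complex_of_real (exp (- (2 * real m + 2) * x)) * exp (- of_int ?k * Complex x y)" .
      have "green_weight (monom 1 m) x y = complex_of_real (1 - exp (- 2 * x)) * ((complex_of_real (exp (- x)) * cis y) ^ m * cis (2 * y))"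
        using True by (simp add: green_weight_def poly_monom)
      then show ?thesis unfolding e of_real_mult
        by (simp only: mult_scaleR_left mult_scaleR_right scaleR_scaleR mult_ac)
    qed
    then have "(\<integral>y. indicator {0<..<2*pi} y *\<^sub>R (green_weight (monom 1 m) x y * zderiv (exp (Complex x y))) \<partial>lborel) =
      complex_of_real ((1 - exp (- 2 * x)) * exp (- (2 * real m + 2) * x)) * (of_int ?k * fcoeff ?k x)"
      using True by (simp only: integral_mult_right_zero integral_zderiv_lborel)
    then show ?thesis using True fcoeff_const[of x 1 ?k] by simp
  qed (auto simp: green_weight_def indicator_def)
  have "green_integral (monom 1 m) = (\<integral>x. \<integral>y. indicator {0<..<2*pi} y *\<^sub>R (green_weight (monom 1 m) x y * zderiv (exp (Complex x y))) \<partial>lborel \<partial>lborel)"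
    unfolding green_integral_def by (rule lborel_pair.integral_fst[OF integrable_green_weight, symmetric])
  also have "\<dots> = of_real (2 / ((2 * real m + 2) * (2 * real m + 2 + 2))) * (of_int ?k * fcoeff ?k 1)"
    unfolding inner integral_mult_left_zero
    by (subst integral_exp_diff_halfline) simp_all
  also have "\<dots> = - fcoeff ?k 1 / (2 * of_nat (m + 1))"
  proof -
    have "(2 * real m + 2) * (2 * real m + 2 + 2) = 2 * (2 * real (m + 1) * real (m + 2))"
      by (simp add: algebra_simps)
    moreover have "2 / (2 * t) = inverse t" for t :: real
      by (simp add: inverse_eq_divide)
    ultimately have e: "2 / ((2 * real m + 2) * (2 * real m + 2 + 2)) = inverse (2 * real (m + 1) * real (m + 2))"
      by (simp only:)
    have k: "of_int ?k = - complex_of_real (real (m + 2))" by simp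
    have "complex_of_real (inverse (2 * a * b)) * (- of_real b * c) = - c / (2 * of_real a)"
      if "a \<noteq> 0" "b \<noteq> 0" for a b c
      using that by (simp add: field_simps)
    from this[of "real (m + 1)" "real (m + 2)"] show ?thesis
      unfolding e k of_real_of_nat_eq by simp
  qed
  finally show ?thesis .
qed

lemma green_integral_sum: "green_integral (\<Sum>i\<in>S. smult (c i) (P i)) = (\<Sum>i\<in>S. c i * green_integral (P i))"
proof -
  have "indicator {0<..<2*pi} y *\<^sub>R (green_weight (\<Sum>i\<in>S. smult (c i) (P i)) x y * zderiv (exp (Complex x y))) =
    (\<Sum>i\<in>S. c i * (indicator {0<..<2*pi} y *\<^sub>R (green_weight (P i) x y * zderiv (exp (Complex x y)))))" for x y
    by (simp add: green_weight_def poly_sum sum_distrib_left sum_distrib_right scaleR_sum_right mult_ac)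
  then have "green_integral (\<Sum>i\<in>S. smult (c i) (P i)) =
    (\<integral>p. (\<Sum>i\<in>S. c i * (case p of (x, y) \<Rightarrow> indicator {0<..<2*pi} y *\<^sub>R (green_weight (P i) x y * zderiv (exp (Complex x y))))) \<partial>(lborel \<Otimes>\<^sub>M lborel))"
    unfolding green_integral_def by (intro Bochner_Integration.integral_cong) auto
  also have "\<dots> = (\<Sum>i\<in>S. c i * green_integral (P i))"
    unfolding green_integral_def
    by (subst Bochner_Integration.integral_sum) (auto intro!: integrable_mult_right integrable_green_weight)
  finally show ?thesis .
qed

lemma green_integral_pderiv:
  "green_integral (pderiv Q) = - (\<Sum>m\<le>degree Q. coeff Q (Suc m) * fcoeff (- int (m + 2)) 1) / 2"
proof -
  have "degree (pderiv Q) \<le> degree Q" by (simp add: degree_pderiv)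
  then have "pderiv Q = (\<Sum>m\<le>degree Q. smult (coeff (pderiv Q) m) (monom 1 m))"
    by (simp add: poly_as_sum_of_monoms' smult_monom)
  then have "green_integral (pderiv Q) = (\<Sum>m\<le>degree Q. coeff (pderiv Q) m * green_integral (monom 1 m))"
    by (metis green_integral_sum)
  also have "\<dots> = (\<Sum>m\<le>degree Q. - (coeff Q (Suc m) * fcoeff (- int (m + 2)) 1) / 2)"
  proof (rule sum.cong[OF refl])
    fix m
    have "s * q * (- c / (2 * s)) = - (q * c) / 2" if "s \<noteq> 0" for s q c :: complex
      using that by simp
    then show "coeff (pderiv Q) m * green_integral (monom 1 m) = - (coeff Q (Suc m) * fcoeff (- int (m + 2)) 1) / 2"
      unfolding green_integral_monom coeff_pderiv Suc_eq_plus1[symmetric] by (metis of_nat_eq_0_iff nat.distinct(1))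
  qed
  finally show ?thesis by (simp add: sum_negf sum_divide_distrib)
qed

text \<open>The constant term of Q is invisible to its derivative and is left over as a separate
  term; all other coefficients are collected by the Green integral.\<close>

lemma jump_pairing:
  fixes Q :: "complex poly"
  defines "h \<equiv> \<lambda>y. indicator {0<..<2*pi} y *\<^sub>R (poly Q (cis y) * (cis y * jump (cis y)))"
  shows "integrable lborel h"
    and "(\<integral>y. h y \<partial>lborel) = - coeff Q 0 * fcoeff (-1) 1 + 2 * green_integral (pderiv Q)"
proof -
  \<comment> \<open>One index beyond the degree: after i = 0 is split off, the shifted range is
    exactly that of \<open>green_integral_pderiv\<close>, also for constant Q.\<close>
  let ?N = "Suc (degree Q)"
  let ?j = "\<lambda>i y. indicator {0<..<2*pi} y *\<^sub>R (jump (cis y) * cis (- of_int (- int (Suc i)) * y))"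
  have h: "h = (\<lambda>y. \<Sum>i\<le>?N. coeff Q i * ?j i y)"
  proof
    fix y
    have e: "cis (- of_int (- int (Suc i)) * y) = cis y ^ i * cis y" for i
      by (simp add: Complex.DeMoivre cis_mult algebra_simps)
    have "coeff Q i * ?j i y = indicator {0<..<2*pi} y *\<^sub>R (coeff Q i * cis y ^ i * (cis y * jump (cis y)))" for i
      unfolding e by (simp only: mult_scaleR_right mult_ac)
    then show "h y = (\<Sum>i\<le>?N. coeff Q i * ?j i y)"
      unfolding h_def poly_eq_sum[of Q ?N "cis y", OF le_SucI[OF order_refl]]
      by (simp only: sum_distrib_right scaleR_sum_right)
  qed
  show "integrable lborel h"
    unfolding h by (intro Bochner_Integration.integrable_sum integrable_mult_right jump_coefficient)
  have "(\<integral>y. h y \<partial>lborel) = (\<Sum>i\<le>?N. \<integral>y. coeff Q i * ?j i y \<partial>lborel)"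
    unfolding h by (intro Bochner_Integration.integral_sum integrable_mult_right jump_coefficient)
  also have "\<dots> = (\<Sum>i\<le>?N. coeff Q i * (fcoeff (- int (Suc i)) (-1) - fcoeff (- int (Suc i)) 1))"
    by (simp only: integral_mult_right_zero jump_coefficient(2))
  also have "\<dots> = - (\<Sum>i\<le>?N. coeff Q i * fcoeff (- int (Suc i)) 1)"
    by (simp only: fcoeff_inner_negative) (simp add: sum_negf)
  also have "\<dots> = - coeff Q 0 * fcoeff (-1) 1 + 2 * green_integral (pderiv Q)"
    unfolding green_integral_pderiv by (subst sum.atMost_Suc_shift) simp
  finally show "(\<integral>y. h y \<partial>lborel) = - coeff Q 0 * fcoeff (-1) 1 + 2 * green_integral (pderiv Q)" .
qed

lemma green_integral_bound:
  obtains A where "A \<ge> 0" "\<And>P B. \<lbrakk>\<And>z. z \<in> ball 0 1 \<Longrightarrow> (1 - cmod z) * cmod (poly P z) \<le> B\<rbrakk> \<Longrightarrow> cmod (green_integral P) \<le> A * B"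
proof -
  let ?w = "\<lambda>x y :: real. (indicator {0..} x :: real) *\<^sub>R (1::complex)"
  let ?F = "\<lambda>(x,y). indicator {0<..<2*pi} y *\<^sub>R (?w x y * zderiv (exp (Complex x y)))"
  \<comment> \<open>For x \<ge> 0 the constant 1 is below exp x, so the exterior part of z f'(z) is
    integrable without further weight.\<close>
  have F: "integrable (lborel \<Otimes>\<^sub>M lborel) ?F"
    by (rule integrable_zderiv_weight[where B = 1]) (auto simp: indicator_def)
  show ?thesis
  proof
    show "2 * (\<integral>p. cmod (?F p) \<partial>(lborel \<Otimes>\<^sub>M lborel)) \<ge> 0" by simp
    fix P B assume B: "\<And>z. z \<in> ball 0 1 \<Longrightarrow> (1 - cmod z) * cmod (poly P z) \<le> B"
    have WB: "cmod (green_weight P x y) \<le> 2 * B * indicator {0..} x" for x y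
    proof (cases "x > 0")
      case True
      let ?z = "complex_of_real (exp (- x)) * cis y"
      have z: "cmod ?z = exp (- x)" by (simp add: norm_mult del: of_real_exp)
      have "cmod (green_weight P x y) = (1 - exp (- 2 * x)) * cmod (poly P ?z)"
        using True unfolding green_weight_def by (simp add: norm_mult del: of_real_diff of_real_exp)
      \<comment> \<open>With |z| = exp (-x) this factors 1 - |z|^2; bounding 1 + |z| by 2 leaves the
        Bloch weight.\<close>
      also have "1 - exp (- 2 * x) = (1 + exp (- x)) * (1 - exp (- x))"
        by (simp add: algebra_simps flip: exp_add)
      also have "\<dots> * cmod (poly P ?z) \<le> 2 * ((1 - cmod ?z) * cmod (poly P ?z))"
        unfolding z mult.assoc using True by (intro mult_right_mono) auto
      also have "\<dots> \<le> 2 * B"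
        using True z by (intro mult_left_mono B) auto
      finally show ?thesis using True by simp
    next
      case False
      \<comment> \<open>For x \<le> 0 the weight is 0, at x = 0 because 1 - exp 0 = 0. Only the sign
        of \<open>B\<close> matters, and the bound at the origin gives it.\<close>
      have "B \<ge> 0" using order_trans[OF norm_ge_zero, of "poly P 0" B] B[of 0] by simp
      then show ?thesis using False by (auto simp: green_weight_def indicator_def)
    qed
    have "cmod (green_integral P) \<le> (\<integral>p. 2 * B * cmod (?F p) \<partial>(lborel \<Otimes>\<^sub>M lborel))"
      unfolding green_integral_def
    proof (rule Bochner_Integration.integral_norm_bound_integral[OF integrable_green_weight])
      show "integrable (lborel \<Otimes>\<^sub>M lborel) (\<lambda>p. 2 * B * cmod (?F p))"
        by (intro integrable_mult_right integrable_norm F)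
      fix p :: "real \<times> real"
      obtain x y where p: "p = (x, y)" by (cases p)
      have "indicator {0<..<2*pi} y * (cmod (green_weight P x y) * cmod (zderiv (exp (Complex x y)))) \<le>
        indicator {0<..<2*pi} y * ((2 * B * indicator {0..} x) * cmod (zderiv (exp (Complex x y))))"
        by (intro mult_left_mono mult_right_mono WB) auto
      then show "cmod (case p of (x, y) \<Rightarrow> indicator {0<..<2*pi} y *\<^sub>R (green_weight P x y * zderiv (exp (Complex x y)))) \<le> 2 * B * cmod (?F p)"
        by (simp add: p norm_mult abs_mult mult_ac)
    qed
    then show "cmod (green_integral P) \<le> 2 * (\<integral>p. cmod (?F p) \<partial>(lborel \<Otimes>\<^sub>M lborel)) * B"
      by (simp add: mult_ac)
  qed
qed

end

section \<open>Duality: testing the SA-property against the jump\<close>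

context sobolev_off_circle
begin

lemma circle_pairing:
  assumes p: "p \<in> borel_measurable (restrict_space borel (sphere 0 1))"
  shows "integrable (restrict_space circle_measure K) (\<lambda>z. p z * (z * jump z)) \<longleftrightarrow>
      integrable lborel (\<lambda>y. indicator {0<..<2*pi} y *\<^sub>R (p (cis y) * (cis y * jump (cis y))))"
    and "(\<integral>z. p z * (z * jump z) \<partial>restrict_space circle_measure K) =
      (\<integral>y. indicator {0<..<2*pi} y *\<^sub>R (p (cis y) * (cis y * jump (cis y))) \<partial>lborel)"
proof -
  have "(\<lambda>z. z) \<in> borel_measurable (restrict_space borel (sphere (0::complex) 1))"
    by (rule measurable_restrict_space1) simp
  then have m: "(\<lambda>z. p z * (z * jump z)) \<in> borel_measurable (restrict_space borel (sphere 0 1))"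
    using p measurable_jump by (intro borel_measurable_times)
  have "indicator K (cis y) *\<^sub>R (p (cis y) * (cis y * jump (cis y))) = p (cis y) * (cis y * jump (cis y))" for y
    using jump_zero[of "cis y"] by (cases "cis y \<in> K") auto
  then show "integrable (restrict_space circle_measure K) (\<lambda>z. p z * (z * jump z)) \<longleftrightarrow>
      integrable lborel (\<lambda>y. indicator {0<..<2*pi} y *\<^sub>R (p (cis y) * (cis y * jump (cis y))))"
    and "(\<integral>z. p z * (z * jump z) \<partial>restrict_space circle_measure K) =
      (\<integral>y. indicator {0<..<2*pi} y *\<^sub>R (p (cis y) * (cis y * jump (cis y))) \<partial>lborel)"
    unfolding circle_measure_integral[OF m compact_K K_sphere] by (simp_all only:)
qed

text \<open>Makes z times the jump an admissible test function for the weak-star topology.\<close>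

lemma jump_in_L1: "(\<lambda>z. z * jump z) \<in> L1_circle K"
  using circle_pairing(1)[of "\<lambda>_. 1"] jump_pairing(1)[of 1] by (simp add: L1_circle_def)

text \<open>Continuity of the pairing in the Bloch norm alone: the two summands of the norm control
  the constant term and the Green integral. The norm appears as a distance from the zero polynomial
  to fit metric balls around it.\<close>

lemma poly_pairing_bound:
  obtains M where "M \<ge> 0" "\<And>Q. cmod (\<integral>z. poly Q z * (z * jump z) \<partial>restrict_space circle_measure K) \<le>
     M * bloch_dist (restrict (poly 0) (ball 0 1)) (restrict (poly Q) (ball 0 1))"
proof -
  obtain A where A: "A \<ge> 0" "\<And>P B. \<lbrakk>\<And>z. z \<in> ball 0 1 \<Longrightarrow> (1 - cmod z) * cmod (poly P z) \<le> B\<rbrakk> \<Longrightarrow> cmod (green_integral P) \<le> A * B"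
    using green_integral_bound by blast
  show ?thesis
  proof
    show "cmod (fcoeff (-1) 1) + 2 * A \<ge> 0" using A(1) by simp
    fix Q :: "complex poly"
    let ?r = "\<lambda>Q. restrict (poly Q) (ball 0 1)"
    let ?S = "SUP z\<in>ball 0 1. (1 - cmod z) * cmod (deriv (?r 0) z - deriv (?r Q) z)"
    let ?d = "bloch_dist (?r 0) (?r Q)"
    have d: "deriv (?r P) z = poly (pderiv P) z" if "z \<in> ball 0 1" for P :: "complex poly" and z
      by (rule DERIV_imp_deriv, rule has_field_derivative_transform_within_open[OF poly_DERIV open_ball that])
        auto
    have S0: "0 \<le> ?S" by (rule little_bloch_diff_Sup_nonneg[OF poly_in_little_bloch poly_in_little_bloch])
    have dist: "?d = cmod (poly Q 0) + ?S"
      by (simp add: bloch_dist_eq[OF poly_in_little_bloch poly_in_little_bloch])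
    have "cmod (green_integral (pderiv Q)) \<le> A * ?S"
    proof (rule A(2))
      fix z :: complex assume z: "z \<in> ball 0 1"
      show "(1 - cmod z) * cmod (poly (pderiv Q) z) \<le> ?S"
        using little_bloch_diff_upper[OF poly_in_little_bloch poly_in_little_bloch z, of 0 Q]
        by (simp add: d[OF z])
    qed
    also have "\<dots> \<le> A * ?d" using A(1) dist by (intro mult_left_mono) auto
    finally have 1: "cmod (green_integral (pderiv Q)) \<le> A * ?d" .
    have 2: "cmod (coeff Q 0 * fcoeff (-1) 1) \<le> cmod (fcoeff (-1) 1) * ?d"
    proof -
      have "cmod (coeff Q 0) \<le> ?d" using dist S0 by (simp add: poly_0_coeff_0)
      from mult_left_mono[OF this norm_ge_zero[of "fcoeff (-1) 1"]] show ?thesis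
        by (simp add: norm_mult mult.commute)
    qed
    have "(\<integral>z. poly Q z * (z * jump z) \<partial>restrict_space circle_measure K) = - coeff Q 0 * fcoeff (-1) 1 + 2 * green_integral (pderiv Q)"
      unfolding jump_pairing(2)[symmetric]
      by (rule circle_pairing(2)[OF measurable_restrict_space1])
        (intro borel_measurable_continuous_onI continuous_intros)
    also have "cmod \<dots> \<le> cmod (coeff Q 0 * fcoeff (-1) 1) + 2 * cmod (green_integral (pderiv Q))"
      using norm_triangle_ineq[of "- coeff Q 0 * fcoeff (-1) 1" "2 * green_integral (pderiv Q)"] by (simp add: norm_mult)
    also have "\<dots> \<le> (cmod (fcoeff (-1) 1) + 2 * A) * ?d"
      using 1 2 by (simp add: algebra_simps)
    finally show "cmod (\<integral>z. poly Q z * (z * jump z) \<partial>restrict_space circle_measure K) \<le>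
      (cmod (fcoeff (-1) 1) + 2 * A) * ?d" .
  qed
qed

lemma SA_coefficients_eq:
  assumes SA: "SA_property K"
  shows "fcoeff (int n) (-1) = fcoeff (int n) 1"
proof -
  \<comment> \<open>The exponent n + 1 cancels the z of the test function and leaves z^(-n), so the
    pairing with \<open>g\<close> is the n-th coefficient of the jump.\<close>
  define g :: "complex \<Rightarrow> complex" where "g z = inverse z ^ Suc n" for z
  let ?M = "restrict_space circle_measure K"
  let ?h = "\<lambda>z. z * jump z"
  let ?r = "\<lambda>Q. restrict (poly Q) (ball 0 1)"
  let ?\<delta> = "fcoeff (int n) (-1) - fcoeff (int n) 1"
  have gm: "g \<in> borel_measurable (restrict_space borel (sphere 0 1))"
    unfolding g_def by (rule borel_measurable_continuous_on_restrict) (auto intro!: continuous_intros)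
  have "g \<in> borel_measurable circle_measure"
    using gm sets_borel_le_circle_measure by (auto simp: measurable_def space_restrict_space)
  then have "g \<in> borel_measurable ?M" by (rule measurable_restrict_space1)
  moreover have "AE x in ?M. cmod (g x) \<le> 1"
    by (intro AE_I2) (auto simp: space_restrict_space g_def norm_mult norm_power norm_inverse)
  ultimately have gL: "g \<in> Linf_circle K" by (auto simp: Linf_circle_def)
  have "g (cis y) * (cis y * jump (cis y)) = jump (cis y) * cis (- of_int (int n) * y)" for y
  proof -
    have "g (cis y) * cis y = inverse (cis y) ^ n" by (simp add: g_def del: cis_inverse)
    also have "\<dots> = cis (- of_int (int n) * y)" by (simp add: Complex.DeMoivre)
    finally have e: "g (cis y) * cis y = cis (- of_int (int n) * y)" .
    show ?thesis unfolding mult.assoc[symmetric] e by (rule mult.commute)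
  qed
  then have gh: "(\<integral>z. g z * ?h z \<partial>?M) = ?\<delta>"
    unfolding circle_pairing(2)[OF gm] by (simp only: jump_coefficient(2))
  obtain M where M: "M \<ge> 0" "\<And>Q. cmod (\<integral>z. poly Q z * ?h z \<partial>?M) \<le> M * bloch_dist (?r 0) (?r Q)"
    using poly_pairing_bound by blast
  \<comment> \<open>A polynomial within e of 0 in the Bloch norm has pairing at most M e; being
    weak-star close to \<open>g\<close>, it also has pairing within e of
    \<open>?\<delta>\<close>.\<close>
  have "cmod ?\<delta> \<le> (M + 1) * e" if e: "e > 0" for e
  proof -
    interpret B: Metric_space little_bloch bloch_dist by (rule Metric_space_little_bloch)
    let ?\<Phi> = "\<lambda>g. \<lambda>h\<in>L1_circle K. \<integral>x. g x * h x \<partial>?M"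
    let ?P = "product_topology (\<lambda>_. euclidean :: complex topology) (L1_circle K)"
    define U where "U = B.mball (?r 0) e"
    \<comment> \<open>Preimage of a subbasic set: only the coordinate of the single test function
      \<open>?h\<close> is constrained.\<close>
    define V0 where "V0 = {u \<in> topspace ?P. u ?h \<in> ball ?\<delta> e}"
    define V where "V = ?\<Phi> -` V0 \<inter> Linf_circle K"
    have U: "openin little_bloch_topology U"
      unfolding U_def little_bloch_topology_def by (rule B.openin_mball)
    have "openin ?P V0"
      unfolding V0_def
      by (rule openin_continuous_map_preimage[OF continuous_map_product_projection[OF jump_in_L1]]) simp
    then have V: "openin (weak_star_topology K) V"
      unfolding V_def weak_star_topology_def openin_pullback_topology by blast
    have "(?r 0, g) \<in> poly_closure K"
      using SA poly_in_little_bloch[of 0] gL by (auto simp: SA_property_def)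
    moreover have "(?r 0, g) \<in> U \<times> V"
    proof -
      have "?\<Phi> g ?h = ?\<delta>" using jump_in_L1 gh by simp
      then have "g \<in> V" using gL e by (auto simp: V_def V0_def PiE_iff)
      moreover have "?r 0 \<in> U" using poly_in_little_bloch[of 0] e by (simp add: U_def)
      ultimately show ?thesis by simp
    qed
    moreover have "openin (prod_topology little_bloch_topology (weak_star_topology K)) (U \<times> V)"
      using U V by (simp add: openin_prod_Times_iff)
    ultimately have "\<exists>q. q \<in> {(?r Q, poly Q) | Q. True} \<and> q \<in> U \<times> V"
      unfolding poly_closure_def in_closure_of by (elim conjE allE[of _ "U \<times> V"]) (simp only: simp_thms)
    then obtain Q where "(?r Q, poly Q) \<in> U \<times> V"
      by (elim exE conjE CollectE) (simp only:)
    then have Q: "bloch_dist (?r 0) (?r Q) < e" "dist ?\<delta> (\<integral>z. poly Q z * ?h z \<partial>?M) < e"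
      using jump_in_L1 by (auto simp: U_def V_def V0_def)
    have "cmod ?\<delta> \<le> dist ?\<delta> (\<integral>z. poly Q z * ?h z \<partial>?M) + cmod (\<integral>z. poly Q z * ?h z \<partial>?M)"
      unfolding dist_norm add.commute[of "cmod (?\<delta> - _)"] by (rule norm_triangle_sub)
    also have "\<dots> \<le> e + M * e"
      using Q M(2)[of Q] mult_left_mono[OF less_imp_le[OF Q(1)] M(1)] by linarith
    finally show ?thesis by (simp add: algebra_simps)
  qed
  from this[of "e / (M + 1)" for e] have "cmod ?\<delta> \<le> 0 + e" if "e > 0" for e
    using M(1) that by simp
  then have "cmod ?\<delta> \<le> 0" by (rule field_le_epsilon)
  then show ?thesis by simp
qed

lemma SA_constant_on_disc:
  assumes "SA_property K" "z \<in> ball 0 1"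
  shows "f z = f 0"
proof (rule holomorphic_fun_eq_const_on_connected[OF holo_ball])
  fix n :: nat assume "0 < n"
  then show "(deriv ^^ n) f 0 = 0"
    using SA_coefficients_eq[OF assms(1), of n] fcoeff_outer_positive[of n] fcoeff_inner[of n] by simp
qed (use assms in auto)

end

section \<open>From the disc to the complement of K\<close>

lemma not_SA_circle: "\<not> SA_property (sphere 0 1)"
proof
  assume SA: "SA_property (sphere 0 1)"
  let ?f = "\<lambda>z::complex. if cmod z < 1 then 1 else 0 :: complex"
  \<comment> \<open>Local constancy off the circle gives derivative 0 there, hence a vanishing area
    integral.\<close>
  have in0: "\<exists>c. \<forall>\<^sub>F w in nhds z. ?f w = c" if "z \<in> - sphere 0 1" for z
  proof (cases "cmod z < 1")
    case True
    then have "\<forall>\<^sub>F w in nhds z. w \<in> ball 0 1" by (intro eventually_nhds_in_open) auto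
    then show ?thesis by (intro exI[of _ 1]) (auto elim!: eventually_mono)
  next
    case False
    then have "\<forall>\<^sub>F w in nhds z. w \<in> - cball 0 1" using that by (intro eventually_nhds_in_open) auto
    then show ?thesis by (intro exI[of _ 0]) (auto elim!: eventually_mono)
  qed
  have der: "(?f has_field_derivative 0) (at z)" if "z \<in> - sphere 0 1" for z
  proof -
    obtain c where "\<forall>\<^sub>F w in nhds z. ?f w = c" using in0 \<open>z \<in> - sphere 0 1\<close> by blast
    then show ?thesis by (subst DERIV_cong_ev[OF refl _ refl, of _ "\<lambda>_. c"]) auto
  qed
  have "?f holomorphic_on - sphere 0 1"
    unfolding holomorphic_on_open[OF open_Compl[OF closed_sphere]] using der by blast
  moreover have "(\<integral>\<^sup>+z\<in>- sphere 0 1. ennreal (cmod (deriv ?f z)) \<partial>lborel) = 0"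
  proof -
    have "ennreal (cmod (deriv ?f z)) * indicator (- sphere 0 1) z = 0" for z
      using DERIV_imp_deriv[OF der, of z] by (cases "z \<in> - sphere 0 1") auto
    then show ?thesis by (simp only: nn_integral_const mult_zero_left)
  qed
  ultimately have "?f \<in> analytic_sobolev (- sphere 0 1)"
    by (simp add: analytic_sobolev_def)
  then interpret S: sobolev_off_circle "sphere 0 1" ?f
    by unfold_locales auto
  have "S.fcoeff 0 (-1) = 2 * pi" using S.fcoeff_inner[of 0] by simp
  moreover have "S.fcoeff 0 1 = 0" by (simp add: S.fcoeff_def)
  ultimately show False using S.SA_coefficients_eq[OF SA, of 0] by simp
qed

text \<open>The disc and the exterior, each enlarged by the arcs missing from \<open>K\<close>, lie
  between a connected set and its closure; a point of the circle outside \<open>K\<close> belongs to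
  both.\<close>

lemma connected_Compl_proper_subset_circle:
  assumes "K \<subseteq> sphere (0::complex) 1" "K \<noteq> sphere 0 1"
  shows "connected (- K)"
proof -
  obtain p where p: "p \<in> sphere 0 1" "p \<notin> K" using assms by blast
  let ?R = "sphere 0 1 - K"
  have "connected (ball 0 1 \<union> ?R)"
    by (rule connected_intermediate_closure[of "ball 0 1"]) (use assms in auto)
  moreover have "connected (- cball 0 1 \<union> ?R)"
  proof (rule connected_intermediate_closure[of "- cball 0 1"])
    show "connected (- cball 0 1 :: complex set)"
      by (rule connected_complement_bounded_convex) auto
    show "- cball 0 1 \<union> ?R \<subseteq> closure (- cball 0 1)"
      by (auto simp: closure_complement)
  qed auto
  moreover have "(ball 0 1 \<union> ?R) \<inter> (- cball 0 1 \<union> ?R) \<noteq> {}" using p by auto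
  ultimately have "connected ((ball 0 1 \<union> ?R) \<union> (- cball 0 1 \<union> ?R))"
    by (rule connected_Un)
  also have "(ball 0 1 \<union> ?R) \<union> (- cball 0 1 \<union> ?R) = - K"
    using assms(1) by auto
  finally show ?thesis .
qed

theorem corollary2p5:
  fixes K :: "complex set"
  assumes "compact K"
    and "K \<subseteq> sphere 0 1"
    and "measure circle_measure K > 0"
    and "SA_property K"
  shows "removable_analytic_sobolev K"
  unfolding removable_analytic_sobolev_def
proof (intro conjI ballI)
  fix f assume f: "f \<in> analytic_sobolev (- K)"
  then interpret sobolev_off_circle K f
    using assms(1,2) by unfold_locales
  have conn: "connected (- K)"
    using assms not_SA_circle by (intro connected_Compl_proper_subset_circle) auto
  have ball: "ball 0 1 \<subseteq> - K" using notin_K by fastforce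
  \<comment> \<open>The identity theorem carries the constant from the disc through the gaps of
    \<open>K\<close> to the exterior.\<close>
  have "f z - f 0 = 0" if "z \<in> - K" for z
  proof (rule analytic_continuation_open[of "ball 0 1" "- K" "\<lambda>z. f z - f 0" "\<lambda>_. 0"])
    show "f w - f 0 = 0" if "w \<in> ball 0 1" for w
      using SA_constant_on_disc[OF assms(4) that] by simp
  qed (use that ball conn open_K in \<open>auto intro!: holomorphic_intros holo\<close>)
  then show "f constant_on - K" unfolding constant_on_def by (metis eq_iff_diff_eq_0)
qed (rule assms(1))

end
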